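(* Let $p$ be a prime, let $k\ge 1$ be an integer, let $g(x)\in\mathbb{Z}[x]$ be a polynomial, and let $a_1,\dots,a_k\in\mathbb{Z}_p$ be such that $g(a_1)\cdots g(a_k)\not\equiv 1\pmod p$. Then $$|W^k_{a,e}|=|W^k_{a,\infty}|=|W^k_{a,1}|$$ for all integers $e\ge1$.
   Context: $\mathbb{Z}_p$ is the ring of $p$-adic integers. Put $q=4$ if $p=2$ and $q=p$ otherwise; $\phi$ is the Euler phi function. For $x\in\mathbb{Z}_p^\times$, $\omega(x)$ is the Teichmüller representative of $x$ (the unique $\phi(q)$-th root of unity in $\mathbb{Z}_p$ congruent to $x$ modulo $q$), and $\langle x\rangle=x/\omega(x)\in1+q\mathbb{Z}_p$; for $z\in\mathbb{Z}_p$, $\langle x\rangle^z=\exp(z\log\langle x\rangle)$. Negative integer powers of units modulo $p^e$ are computed using inverses modulo $p^e$. A tuple $(x_1,\dots,x_k)$ of integers is a rooted closed walk of length $k$ modulo $p^e$ associated with the map $x\mapsto x^{g(x)}$ if $x_1^{g(x_1)}\equiv x_2$, $x_2^{g(x_2)}\equiv x_3$, $\ldots$, $x_{k-1}^{g(x_{k-1})}\equiv x_k$, $x_k^{g(x_k)}\equiv x_1 \pmod{p^e}$. For $a=(a_1,\dots,a_k)\in\mathbb{Z}_p^k$ and $e\ge1$, $W^k_{a,e}$ is the set of rooted closed walks $(x_1,\dots,x_k)$ of length $k$ modulo $p^e$ associated with $x\mapsto x^{g(x)}$ such that $1\le x_i\le p^e(p-1)$, $p\nmid x_i$, and $x_i\equiv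 a_i\pmod q$ for all $i=1,\dots,k$. $W^k_{a,\infty}$ is the set of tuples $(x_1,\dots,x_k,x_{01},\dots,x_{0k})\in\mathbb{Z}_p^k\times\{1,\dots,p-1\}^k$ such that $p\nmid x_i$ and $x_i\equiv a_i\pmod q$ for all $i$, and $$\omega(x_1)^{g(x_{01})}\langle x_1\rangle^{g(x_1)}=x_2,\quad\ldots,\quad\omega(x_k)^{g(x_{0k})}\langle x_k\rangle^{g(x_k)}=x_1.$$ *)

theory Defs
  imports
    "HOL-Number_Theory.Number_Theory"
    "HOL-Number_Theory.Modular_Inverse"
    "Berlekamp_Zassenhaus.Finite_Field"
begin

section \<open>The ring of \<open>p\<close>-adic integers\<close>

text \<open>
  The prime \<open>p\<close> is represented by a type \<open>'p\<close> of prime cardinality, \<open>p = CARD('p)\<close>.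
  A \<open>p\<close>-adic integer is a compatible sequence of residues, i.e. an element of the inverse limit
  of the rings of integers modulo \<open>p ^ n\<close>; the \<open>n\<close>-th entry is the representative in
  \<open>{0..<p ^ n}\<close>.
\<close>

typedef (overloaded) 'p padic_int =
  "{x :: nat \<Rightarrow> int. \<forall>n. x n = x (Suc n) mod int CARD('p :: prime_card) ^ n}"
  morphisms residue Abs_padic_int
  by (rule exI[of _ "\<lambda>_. 0"]) simp

setup_lifting type_definition_padic_int

lemma padic_int_eqI: "(\<And>n. residue x n = residue y n) \<Longrightarrow> x = y"
  by (simp add: residue_inject[symmetric] fun_eq_iff)

lemma residue_Suc_mod: "residue (x :: 'p::prime_card padic_int) (Suc n) mod int CARD('p) ^ n = residue x n"
  by (rule residue[THEN CollectD, THEN spec, symmetric])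

lemma residue_mod: "residue (x :: 'p::prime_card padic_int) n mod int CARD('p) ^ n = residue x n"
  by (metis residue_Suc_mod mod_mod_trivial)

lemma residue_add_mod:
  "residue (x :: 'p::prime_card padic_int) (m + n) mod int CARD('p) ^ n = residue x n"
proof (induction m)
  case 0
  show ?case by (simp add: residue_mod)
next
  case (Suc m)
  have "residue x (Suc m + n) mod int CARD('p) ^ n
      = residue x (Suc (m + n)) mod int CARD('p) ^ (m + n) mod int CARD('p) ^ n"
    by (simp add: mod_mod_cancel power_add)
  then show ?case using Suc by (simp add: residue_Suc_mod)
qed

lemma mod_power_Suc_cancel: "(a :: int) mod b ^ Suc n mod b ^ n = a mod b ^ n"
  by (rule mod_mod_cancel) simp

instantiation padic_int :: (prime_card) comm_ring_1
begin

lift_definition zero_padic_int :: "'a padic_int" is "\<lambda>_. 0" by simp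

lift_definition one_padic_int :: "'a padic_int" is "\<lambda>n. 1 mod int CARD('a) ^ n"
  by (simp only: mod_power_Suc_cancel simp_thms)

lift_definition plus_padic_int :: "'a padic_int \<Rightarrow> 'a padic_int \<Rightarrow> 'a padic_int"
  is "\<lambda>x y n. (x n + y n) mod int CARD('a) ^ n"
  unfolding mod_power_Suc_cancel
proof -
  fix x y :: "nat \<Rightarrow> int" and n
  assume *: "\<And>n. x n = x (Suc n) mod int CARD('a) ^ n" "\<And>n. y n = y (Suc n) mod int CARD('a) ^ n"
  show "(x n + y n) mod int CARD('a) ^ n = (x (Suc n) + y (Suc n)) mod int CARD('a) ^ n"
    by (subst *(1), subst *(2)) (rule mod_add_eq)
qed

lift_definition minus_padic_int :: "'a padic_int \<Rightarrow> 'a padic_int \<Rightarrow> 'a padic_int"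
  is "\<lambda>x y n. (x n - y n) mod int CARD('a) ^ n"
  unfolding mod_power_Suc_cancel
proof -
  fix x y :: "nat \<Rightarrow> int" and n
  assume *: "\<And>n. x n = x (Suc n) mod int CARD('a) ^ n" "\<And>n. y n = y (Suc n) mod int CARD('a) ^ n"
  show "(x n - y n) mod int CARD('a) ^ n = (x (Suc n) - y (Suc n)) mod int CARD('a) ^ n"
    by (subst *(1), subst *(2)) (rule mod_diff_eq)
qed

lift_definition uminus_padic_int :: "'a padic_int \<Rightarrow> 'a padic_int"
  is "\<lambda>x n. (- x n) mod int CARD('a) ^ n"
  unfolding mod_power_Suc_cancel
proof -
  fix x :: "nat \<Rightarrow> int" and n
  assume *: "\<And>n. x n = x (Suc n) mod int CARD('a) ^ n"
  show "(- x n) mod int CARD('a) ^ n = (- x (Suc n)) mod int CARD('a) ^ n"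
    by (subst *) (rule mod_minus_eq)
qed

lift_definition times_padic_int :: "'a padic_int \<Rightarrow> 'a padic_int \<Rightarrow> 'a padic_int"
  is "\<lambda>x y n. (x n * y n) mod int CARD('a) ^ n"
  unfolding mod_power_Suc_cancel
proof -
  fix x y :: "nat \<Rightarrow> int" and n
  assume *: "\<And>n. x n = x (Suc n) mod int CARD('a) ^ n" "\<And>n. y n = y (Suc n) mod int CARD('a) ^ n"
  show "(x n * y n) mod int CARD('a) ^ n = (x (Suc n) * y (Suc n)) mod int CARD('a) ^ n"
    by (subst *(1), subst *(2)) (rule mod_mult_eq)
qed

lemmas residue_simps = zero_padic_int.rep_eq one_padic_int.rep_eq plus_padic_int.rep_eq
  minus_padic_int.rep_eq uminus_padic_int.rep_eq times_padic_int.rep_eq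

instance
proof
  fix a b c :: "'a padic_int"
  show "a + b + c = a + (b + c)"
    by (rule padic_int_eqI) (simp add: residue_simps mod_simps add.assoc)
  show "a + b = b + a"
    by (rule padic_int_eqI) (simp add: residue_simps add.commute)
  show "0 + a = a"
    by (rule padic_int_eqI) (simp add: residue_simps residue_mod)
  show "- a + a = 0"
    by (rule padic_int_eqI) (simp add: residue_simps mod_simps)
  show "a - b = a + - b"
    by (rule padic_int_eqI) (simp add: residue_simps mod_simps)
  show "a * b * c = a * (b * c)"
    by (rule padic_int_eqI) (simp add: residue_simps mod_simps mult.assoc)
  show "a * b = b * a"
    by (rule padic_int_eqI) (simp add: residue_simps mult.commute)
  show "1 * a = a"
    by (rule padic_int_eqI) (simp add: residue_simps mod_simps residue_mod)
  show "(a + b) * c = a * c + b * c"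
    by (rule padic_int_eqI) (simp add: residue_simps mod_simps distrib_right)
  have "CARD('a) > 1" by (rule nontriv)
  then have "residue (1 :: 'a padic_int) 1 \<noteq> residue 0 1"
    by (simp add: residue_simps)
  then show "(0 :: 'a padic_int) \<noteq> 1"
    by metis
qed

end

lemma residue_of_nat:
  "residue (of_nat k :: 'p::prime_card padic_int) n = int k mod int CARD('p) ^ n"
  by (induction k) (simp_all add: zero_padic_int.rep_eq one_padic_int.rep_eq
      plus_padic_int.rep_eq mod_simps)

lemma residue_of_int:
  "residue (of_int k :: 'p::prime_card padic_int) n = k mod int CARD('p) ^ n"
  by (cases k) (simp_all add: residue_of_nat one_padic_int.rep_eq minus_padic_int.rep_eq
      uminus_padic_int.rep_eq plus_padic_int.rep_eq mod_simps)

instance padic_int :: (prime_card) ring_char_0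
proof
  show "inj (of_nat :: nat \<Rightarrow> 'a padic_int)"
  proof (rule injI)
    fix k l :: nat
    assume eq: "(of_nat k :: 'a padic_int) = of_nat l"
    define N where "N = k + l"
    have "CARD('a) > 1" by (rule nontriv)
    then have "N < CARD('a) ^ N" by (intro power_gt_expt) simp
    then have "int N < int CARD('a) ^ N" by (metis of_nat_less_iff of_nat_power)
    moreover have "int k \<le> int N" "int l \<le> int N" by (simp_all add: N_def)
    ultimately have "int k < int CARD('a) ^ N" "int l < int CARD('a) ^ N" by linarith+
    moreover have "int k mod int CARD('a) ^ N = int l mod int CARD('a) ^ N"
      using eq by (metis residue_of_nat)
    ultimately show "k = l" by simp
  qed
qed

instance padic_int :: (prime_card) idom
proof
  fix x y :: "'a padic_int"
  let ?p = "int CARD('a)"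
  assume "x \<noteq> 0" "y \<noteq> 0"
  then obtain m n where mn: "residue x m \<noteq> 0" "residue y n \<noteq> 0"
    by (metis padic_int_eqI zero_padic_int.rep_eq)
  let ?X = "residue x (m + n)" and ?Y = "residue y (m + n)"
  have nd: "\<not> ?p ^ m dvd ?X" "\<not> ?p ^ n dvd ?Y"
    using mn residue_add_mod[of x n m] residue_add_mod[of y m n]
    by (simp_all add: dvd_eq_mod_eq_0 add.commute)
  have "\<not> ?p ^ (m + n) dvd ?X * ?Y"
  proof
    assume "?p ^ (m + n) dvd ?X * ?Y"
    moreover have "prime_elem ?p" using prime_card_int by (rule prime_imp_prime_elem)
    ultimately obtain i j where ij: "i + j = m + n" "?p ^ i dvd ?X" "?p ^ j dvd ?Y"
      using prime_elem_power_dvd_prod by blast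
    then have "m \<le> i \<or> n \<le> j" by linarith
    with ij nd show False by (meson dvd_trans le_imp_power_dvd)
  qed
  then have "residue (x * y) (m + n) \<noteq> 0"
    by (simp add: times_padic_int.rep_eq dvd_eq_mod_eq_0)
  then show "x * y \<noteq> 0"
    by (auto simp: zero_padic_int.rep_eq)
qed

text \<open>
  Division in the sense of exact division: \<open>x div y\<close> is the quotient of \<open>x\<close> and \<open>y\<close> in the
  fraction field whenever that quotient is again a \<open>p\<close>-adic integer, and \<open>0\<close> otherwise.
  Since \<open>(/)\<close> is the same operation as \<open>(div)\<close>, quotients are written with \<open>(/)\<close> below.
\<close>

instantiation padic_int :: (prime_card) "{idom_divide, algebraic_semidom, inverse}"
begin

definition divide_padic_int :: "'a padic_int \<Rightarrow> 'a padic_int \<Rightarrow> 'a padic_int" where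
  "divide_padic_int x y = (if y \<noteq> 0 \<and> y dvd x then (THE z. x = y * z) else 0)"

definition inverse_padic_int :: "'a padic_int \<Rightarrow> 'a padic_int" where
  "inverse_padic_int x = 1 div x"

instance
proof
  fix a b :: "'a padic_int"
  show "a * b div b = a" if "b \<noteq> 0"
    using that by (auto simp: divide_padic_int_def mult.commute)
  show "a div 0 = 0"
    by (simp add: divide_padic_int_def)
qed

end

lemma power_dvd_padic_int_iff:
  fixes x :: "'p::prime_card padic_int"
  shows "of_nat CARD('p) ^ n dvd x \<longleftrightarrow> residue x n = 0"
proof
  let ?p = "int CARD('p)"
  assume "of_nat CARD('p) ^ n dvd x"
  then obtain y where "x = of_nat (CARD('p) ^ n) * y" by (auto elim: dvdE)
  then show "residue x n = 0"
    by (simp only: times_padic_int.rep_eq residue_of_nat) simp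
next
  let ?p = "int CARD('p)"
  assume 0: "residue x n = 0"
  have p: "?p > 0" using nontriv[where 'a = 'p] by simp
  have dvd: "?p ^ n dvd residue x (m + n)" for m
    using residue_add_mod[of x m n] 0 by (simp add: dvd_eq_mod_eq_0)
  define f where "f = (\<lambda>m. residue x (m + n) div ?p ^ n)"
  have "f m = f (Suc m) mod ?p ^ m" for m
  proof -
    have "residue x (m + n) = residue x (Suc m + n) mod (?p ^ n * ?p ^ m)"
      using residue_Suc_mod[of x "m + n"] by (simp add: power_add mult.commute)
    also have "\<dots> = ?p ^ n * (residue x (Suc m + n) div ?p ^ n mod ?p ^ m)
        + residue x (Suc m + n) mod ?p ^ n"
      using p by (intro zmod_zmult2_eq) simp
    also have "residue x (Suc m + n) mod ?p ^ n = 0"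
      using dvd[of "Suc m"] by (simp only: dvd_eq_mod_eq_0)
    finally show ?thesis using p by (simp add: f_def)
  qed
  then have res: "residue (Abs_padic_int f :: 'p padic_int) = f"
    by (intro Abs_padic_int_inverse) blast
  have "x = of_nat (CARD('p) ^ n) * Abs_padic_int f"
  proof (rule padic_int_eqI)
    fix m
    have "residue (of_nat (CARD('p) ^ n) * Abs_padic_int f :: 'p padic_int) m
        = ?p ^ n * f m mod ?p ^ m"
      by (simp only: times_padic_int.rep_eq residue_of_nat res) (simp add: mod_simps)
    also have "?p ^ n * f m = residue x (n + m)"
      using dvd[of m] by (simp add: f_def add.commute)
    finally show "residue x m = residue (of_nat (CARD('p) ^ n) * Abs_padic_int f :: 'p padic_int) m"
      by (simp add: residue_add_mod)
  qed
  then show "of_nat CARD('p) ^ n dvd x" by (metis dvd_triv_left of_nat_power)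
qed

lemma p_not_unit_padic_int: "\<not> is_unit (of_nat CARD('p) :: 'p::prime_card padic_int)"
proof
  assume "is_unit (of_nat CARD('p) :: 'p padic_int)"
  then have "residue (1 :: 'p padic_int) 1 = 0"
    using power_dvd_padic_int_iff[of 1 "1 :: 'p padic_int"] by simp
  then show False
    using nontriv[where 'a = 'p] by (simp add: one_padic_int.rep_eq)
qed

lemma finite_p_powers_dvd:
  fixes x :: "'p::prime_card padic_int"
  assumes "x \<noteq> 0"
  shows "finite {n. of_nat CARD('p) ^ n dvd x}"
proof -
  from assms obtain m where m: "residue x m \<noteq> 0"
    by (metis padic_int_eqI zero_padic_int.rep_eq)
  have "n < m" if "of_nat CARD('p) ^ n dvd x" for n
  proof (rule ccontr)
    assume "\<not> n < m"
    then have "of_nat CARD('p) ^ m dvd x"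
      using that by (meson dvd_trans le_imp_power_dvd not_less)
    with m show False by (simp add: power_dvd_padic_int_iff)
  qed
  then have "{n. of_nat CARD('p) ^ n dvd x} \<subseteq> {..<m}" by blast
  then show ?thesis using finite_subset by blast
qed

lemma power_dvd_padic_int_iff_le:
  fixes x :: "'p::prime_card padic_int"
  assumes "x \<noteq> 0"
  shows "of_nat CARD('p) ^ n dvd x \<longleftrightarrow> n \<le> Max {n. of_nat CARD('p) ^ n dvd x}"
proof
  let ?S = "{n. of_nat CARD('p) ^ n dvd x}"
  show "n \<le> Max ?S" if "of_nat CARD('p) ^ n dvd x"
    using finite_p_powers_dvd[OF assms] that by simp
  assume le: "n \<le> Max ?S"
  have "0 \<in> ?S" by simp
  then have "Max ?S \<in> ?S" using finite_p_powers_dvd[OF assms] Max_in by blast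
  then have "of_nat CARD('p) ^ Max ?S dvd x" by simp
  with le_imp_power_dvd[OF le] show "of_nat CARD('p) ^ n dvd x" by (rule dvd_trans)
qed

text \<open>The \<open>p\<close>-adic metric, so that limits and infinite sums are \<open>p\<close>-adic ones.\<close>

instantiation padic_int :: (prime_card) metric_space
begin

definition dist_padic_int :: "'a padic_int \<Rightarrow> 'a padic_int \<Rightarrow> real" where
  "dist_padic_int x y = (if x = y then 0
     else 1 / real CARD('a) ^ Max {n. of_nat CARD('a) ^ n dvd x - y})"

definition uniformity_padic_int :: "('a padic_int \<times> 'a padic_int) filter" where
  "uniformity_padic_int = (INF e\<in>{0<..}. principal {(x, y). dist x y < e})"

definition open_padic_int :: "'a padic_int set \<Rightarrow> bool" where
  "open_padic_int U \<longleftrightarrow> (\<forall>x\<in>U. eventually (\<lambda>(x', y). x' = x \<longrightarrow> y \<in> U) uniformity)"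

instance
proof
  fix x y z :: "'a padic_int"
  let ?p = "of_nat CARD('a) :: 'a padic_int"
  let ?v = "\<lambda>x. Max {n. ?p ^ n dvd x}"
  have p: "real CARD('a) > 1" using nontriv[where 'a = 'a] by simp
  show "dist x y = 0 \<longleftrightarrow> x = y"
    using p by (auto simp: dist_padic_int_def)
  have nonneg: "dist a b \<ge> 0" for a b :: "'a padic_int"
    by (simp add: dist_padic_int_def)
  show "dist x y \<le> dist x z + dist y z"
  proof (cases "x = y \<or> x = z \<or> y = z")
    case True
    have commute: "dist a b = dist b a" for a b :: "'a padic_int"
    proof -
      have "?p ^ n dvd a - b \<longleftrightarrow> ?p ^ n dvd b - a" for n
        by (metis dvd_minus_iff minus_diff_eq)
      then show ?thesis by (simp add: dist_padic_int_def)
    qed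
    have self: "dist a a = 0" for a :: "'a padic_int" by (simp add: dist_padic_int_def)
    from True consider "x = y" | "x = z" | "y = z" by blast
    then show ?thesis
    proof cases
      case 1
      then show ?thesis using nonneg[of x z] self[of x] by simp
    next
      case 2
      then show ?thesis using commute[of x y] self[of x] by simp
    next
      case 3
      then show ?thesis using self[of y] by simp
    qed
  next
    case False
    then have nz: "x - y \<noteq> 0" "x - z \<noteq> 0" "y - z \<noteq> 0" by auto
    define m where "m = min (?v (x - z)) (?v (y - z))"
    have "?p ^ m dvd x - z" "?p ^ m dvd y - z"
      unfolding m_def
      by (rule power_dvd_padic_int_iff_le[THEN iffD2], use nz in simp, simp)+
    then have "?p ^ m dvd x - y" using dvd_diff[of "?p ^ m" "x - z" "y - z"] by simp
    then have "m \<le> ?v (x - y)"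
      by (rule power_dvd_padic_int_iff_le[OF nz(1), THEN iffD1])
    then have "dist x y \<le> 1 / real CARD('a) ^ m"
      using False p by (simp add: dist_padic_int_def frac_le)
    also have "\<dots> \<le> dist x z + dist y z"
      using False p by (simp add: dist_padic_int_def m_def min_def)
    finally show ?thesis .
  qed
qed (rule uniformity_padic_int_def open_padic_int_def)+

end


section \<open>Teichmueller representatives, exponential, logarithm\<close>

definition padic_q :: "nat \<Rightarrow> nat" where
  "padic_q p = (if p = 2 then 4 else p)"

definition teichmueller :: "'p::prime_card padic_int \<Rightarrow> 'p padic_int" where
  "teichmueller x = (THE w. w ^ totient (padic_q CARD('p)) = 1 \<and>
     of_nat (padic_q CARD('p)) dvd w - x)"

definition one_unit_part :: "'p::prime_card padic_int \<Rightarrow> 'p padic_int" where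
  "one_unit_part x = x / teichmueller x"

text \<open>
  The usual power series, for \<open>z\<close> in \<open>qZ\<^sub>p\<close> and \<open>x\<close> in \<open>1 + qZ\<^sub>p\<close> respectively.
  There all quotients \<open>z ^ n / n!\<close> and \<open>(x - 1) ^ n / n\<close> are \<open>p\<close>-adic integers, so the exact
  division in \<open>Z\<^sub>p\<close> coincides with the division in \<open>Q\<^sub>p\<close>.
\<close>

definition padic_exp :: "'p::prime_card padic_int \<Rightarrow> 'p padic_int" where
  "padic_exp z = (\<Sum>n. z ^ n / fact n)"

definition padic_log :: "'p::prime_card padic_int \<Rightarrow> 'p padic_int" where
  "padic_log x = (\<Sum>n. (- 1) ^ n * ((x - 1) ^ Suc n / of_nat (Suc n)))"

definition one_unit_power :: "'p::prime_card padic_int \<Rightarrow> 'p padic_int \<Rightarrow> 'p padic_int" where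
  "one_unit_power x z = padic_exp (z * padic_log (one_unit_part x))"


section \<open>Rooted closed walks\<close>

text \<open>
  \<open>x ^ n\<close> modulo \<open>m\<close> for an integer exponent \<open>n\<close>; negative exponents are meaningful only for
  \<open>x\<close> coprime to \<open>m\<close>.
\<close>

definition powi_mod :: "int \<Rightarrow> int \<Rightarrow> int \<Rightarrow> int" where
  "powi_mod m x n = (if n \<ge> 0 then x ^ nat n else modular_inverse m x ^ nat (- n)) mod m"

text \<open>
  Tuples are lists, indexed from \<open>0\<close>; \<open>Suc i mod k\<close> is the cyclic successor of the index \<open>i\<close>.
\<close>

definition rooted_closed_walk :: "int poly \<Rightarrow> int \<Rightarrow> nat \<Rightarrow> int list \<Rightarrow> bool" where
  "rooted_closed_walk g m k xs \<longleftrightarrow> length xs = k \<and>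
     (\<forall>i<k. [powi_mod m (xs ! i) (poly g (xs ! i)) = xs ! (Suc i mod k)] (mod m))"

definition walks :: "int poly \<Rightarrow> nat \<Rightarrow> 'p::prime_card padic_int list \<Rightarrow> nat \<Rightarrow> int list set" where
  "walks g k a e = {xs. rooted_closed_walk g (int CARD('p) ^ e) k xs \<and>
     (\<forall>i<k. 1 \<le> xs ! i \<and> xs ! i \<le> int CARD('p) ^ e * (int CARD('p) - 1) \<and>
        \<not> int CARD('p) dvd xs ! i \<and>
        of_nat (padic_q CARD('p)) dvd of_int (xs ! i) - a ! i)}"

abbreviation poly_padic :: "int poly \<Rightarrow> 'p::prime_card padic_int \<Rightarrow> 'p padic_int" where
  "poly_padic g x \<equiv> poly (map_poly of_int g) x"

definition walks_inf ::
  "int poly \<Rightarrow> nat \<Rightarrow> 'p::prime_card padic_int list \<Rightarrow> ('p padic_int list \<times> int list) set" where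
  "walks_inf g k a = {(xs, x0s). length xs = k \<and> length x0s = k \<and>
     (\<forall>i<k. x0s ! i \<in> {1..int CARD('p) - 1} \<and>
        \<not> of_nat CARD('p) dvd xs ! i \<and>
        of_nat (padic_q CARD('p)) dvd xs ! i - a ! i \<and>
        teichmueller (xs ! i) powi poly g (x0s ! i) *
          one_unit_power (xs ! i) (poly_padic g (xs ! i)) = xs ! (Suc i mod k))}"

end

theory Submission
  imports Defs
begin

text \<open>
  If some \<open>a\<^sub>i\<close> is divisible by \<open>p\<close> there are no walks at all, so let all \<open>a\<^sub>i\<close> be units. A pair
  \<open>(x\<^sub>0, x)\<close> of a residue modulo \<open>p - 1\<close> and a \<open>p\<close>-adic unit is sent to
  \<open>\<omega>(x)\<close> raised to \<open>g(x\<^sub>0)\<close>, times \<open>\<langle>x\<rangle>\<close> raised to \<open>g(x)\<close> (\<open>walk_map\<close>). For an integer \<open>x\<close>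
  congruent to \<open>x\<^sub>0\<close> modulo \<open>p - 1\<close> this is \<open>x\<close> raised to \<open>g(x)\<close> exactly (\<open>walk_map_of_int\<close>). Hence, by the
  Chinese remainder theorem, walks modulo \<open>p\<^sup>e\<close> are solutions modulo \<open>p\<^sup>e\<close> of the equations whose
  solutions in \<open>Z\<^sub>p\<close> are the elements of \<open>walks_inf\<close>.

  Modulo \<open>q\<close> those equations involve the residues \<open>x\<^sub>0\<^sub>i\<close> alone; the tuples that satisfy them
  there form the set \<open>residue_cycles\<close>. Every such tuple lifts uniquely, to \<open>Z\<^sub>p\<close> as
  well as to each modulus \<open>p\<^sup>e\<close> divisible by \<open>q\<close>: on the disc \<open>a\<^sub>i + q Z\<^sub>p\<close> the map has
  derivative \<open>g(a\<^sub>i) a\<^sub>i\<^sub>+\<^sub>1 / a\<^sub>i\<close> modulo \<open>p\<close> (\<open>walk_map_diff\<close>), so going once around the cycle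
  multiplies distances by the product of the \<open>g(a\<^sub>i)\<close>. As that product is not \<open>1\<close> modulo
  \<open>p\<close>, Hensel's lemma applies to the fixed points of the composition (locale \<open>cyclic_system\<close>).
  Thus all the sets in question are in bijection with \<open>residue_cycles\<close>. The remaining modulus
  \<open>p\<^sup>e = 2\<close>, which is not divisible by \<open>q = 4\<close>, is treated by hand (\<open>walks_2_1\<close>).

  The derivative rests on \<open>\<langle>x\<rangle>\<^sup>z = exp(z log \<langle>x\<rangle>)\<close> being the continuous extension of the powers with
  natural exponents, that is, on \<open>exp(a + b) = exp(a) exp(b)\<close> and \<open>exp(log u) = u\<close>. The second
  identity is obtained without composing power series: for \<open>N = p\<^sup>t\<close> both
  \<open>exp(log u)\<^sup>N = exp(N log u)\<close> and \<open>u\<^sup>N\<close> agree with \<open>1 + N log u\<close> modulo \<open>N\<^sup>2\<close>, and taking \<open>N\<close>-th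
  roots near \<open>1\<close> loses a factor \<open>N\<close> only (\<open>padic_exp_log\<close>).
\<close>

section \<open>Congruences, units and limits in the \<open>p\<close>-adic integers\<close>

definition uniformizer :: "'p::prime_card padic_int" (\<open>\<pi>\<close>) where
  "\<pi> = of_nat CARD('p)"

lemma uniformizer_power_dvd_iff: "\<pi> ^ n dvd x \<longleftrightarrow> residue x n = 0"
  by (simp add: uniformizer_def power_dvd_padic_int_iff)

lemma uniformizer_power_dvd_diff_iff:
  "\<pi> ^ n dvd x - y \<longleftrightarrow> residue x n = residue (y :: 'p::prime_card padic_int) n"
proof -
  have "residue (x - y) n = 0 \<longleftrightarrow> [residue x n = residue y n] (mod int CARD('p) ^ n)"
    by (simp add: minus_padic_int.rep_eq cong_iff_dvd_diff dvd_eq_mod_eq_0)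
  then show ?thesis
    by (simp add: uniformizer_power_dvd_iff Cong.cong_def residue_mod)
qed

lemma residue_mod_le:
  assumes "n \<le> m"
  shows "residue (x :: 'p::prime_card padic_int) m mod int CARD('p) ^ n = residue x n"
  using residue_add_mod[of x "m - n" n] assms by simp

lemma uniformizer_nonzero [simp]: "(\<pi> :: 'p::prime_card padic_int) \<noteq> 0"
  by (simp add: uniformizer_def)

lemma uniformizer_not_unit: "\<not> is_unit (\<pi> :: 'p::prime_card padic_int)"
  unfolding uniformizer_def by (rule p_not_unit_padic_int)

lemma CARD_gt_1: "CARD('p::prime_card) > 1"
  by (rule nontriv)

lemma of_int_power_dvd_iff:
  "\<pi> ^ n dvd (of_int k :: 'p::prime_card padic_int) \<longleftrightarrow> int CARD('p) ^ n dvd k"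
  by (simp add: uniformizer_power_dvd_iff residue_of_int dvd_eq_mod_eq_0)

lemma of_int_dvd_iff:
  "\<pi> dvd (of_int k :: 'p::prime_card padic_int) \<longleftrightarrow> int CARD('p) dvd k"
  using of_int_power_dvd_iff[of 1 k] by simp

lemma of_nat_dvd_iff:
  "\<pi> dvd (of_nat k :: 'p::prime_card padic_int) \<longleftrightarrow> CARD('p) dvd k"
  using of_int_dvd_iff[of "int k"] by simp

lemma eq_0_if_all_powers_dvd: "(\<And>n. \<pi> ^ n dvd x) \<Longrightarrow> x = 0"
  by (intro padic_int_eqI) (simp add: uniformizer_power_dvd_iff zero_padic_int.rep_eq)

text \<open>Inverses exist modulo every power of \<open>p\<close>, and they are unique there, hence compatible.\<close>

lemma unit_iff: "is_unit x \<longleftrightarrow> \<not> \<pi> dvd (x :: 'p::prime_card padic_int)"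
proof
  assume "is_unit x"
  then show "\<not> \<pi> dvd x"
    using uniformizer_not_unit dvd_trans by blast
next
  let ?p = "int CARD('p)"
  assume nd: "\<not> \<pi> dvd x"
  have cop: "coprime (residue x n) (?p ^ n)" for n
  proof (cases n)
    case (Suc m)
    have "\<not> ?p dvd residue x n"
    proof
      assume "?p dvd residue x n"
      then have "residue x 1 = 0"
        using residue_mod_le[of 1 n x] Suc by (simp add: dvd_eq_mod_eq_0)
      with nd uniformizer_power_dvd_iff[of 1 x] show False by simp
    qed
    then have "coprime ?p (residue x n)"
      using prime_card_int prime_imp_coprime by blast
    then show ?thesis by (simp add: coprime_commute)
  qed simp
  define f where "f n = modular_inverse (?p ^ n) (residue x n)" for n
  have f_inv: "[residue x n * f n = 1] (mod ?p ^ n)" for n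
    unfolding f_def by (rule cong_modular_inverse1[OF cop])
  have "f n = f (Suc n) mod ?p ^ n" for n
  proof -
    have pos: "?p ^ n > 0" using CARD_gt_1[where 'p = 'p] by simp
    have "[residue x (Suc n) * f (Suc n) = 1] (mod ?p ^ n)"
      by (rule cong_modulus_mult[where n = ?p]) (use f_inv[of "Suc n"] in \<open>simp add: mult.commute\<close>)
    moreover have "[residue x (Suc n) = residue x n] (mod ?p ^ n)"
      by (simp add: Cong.cong_def residue_Suc_mod residue_mod)
    ultimately have "[residue x n * f (Suc n) = residue x n * f n] (mod ?p ^ n)"
      using f_inv[of n] by (metis cong_scalar_right cong_sym cong_trans)
    then have "[f (Suc n) = f n] (mod ?p ^ n)"
      using cop cong_mult_lcancel by blast
    moreover have "f n mod ?p ^ n = f n"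
      using pos by (simp add: f_def modular_inverse_int_nonneg modular_inverse_int_less)
    ultimately show ?thesis by (simp add: Cong.cong_def)
  qed
  then have res: "residue (Abs_padic_int f :: 'p padic_int) = f"
    by (intro Abs_padic_int_inverse) blast
  have "x * Abs_padic_int f = 1"
    using f_inv by (intro padic_int_eqI)
      (simp add: times_padic_int.rep_eq one_padic_int.rep_eq res Cong.cong_def)
  then show "is_unit x" by (metis dvd_triv_left)
qed

lemma unit_if_near_unit:
  assumes "\<pi> dvd x - y" "is_unit (y :: 'p::prime_card padic_int)"
  shows "is_unit x"
  using assms dvd_diff[of \<pi> x "x - y"] by (auto simp: unit_iff)

lemma dvd_diff_sym: "(d :: 'a::comm_ring_1) dvd x - y \<longleftrightarrow> d dvd y - x"
  by (metis dvd_minus_iff minus_diff_eq)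

lemma dvd_diff_trans: "(d :: 'a::comm_ring_1) dvd x - y \<Longrightarrow> d dvd y - z \<Longrightarrow> d dvd x - z"
  using dvd_add by fastforce

lemma dvd_diff_mult:
  assumes "(d :: 'a::comm_ring_1) dvd x - x'" "d dvd y - y'"
  shows "d dvd x * y - x' * y'"
proof -
  have "x * y - x' * y' = (x - x') * y + x' * (y - y')" by (simp add: algebra_simps)
  with assms show ?thesis by (metis dvd_add dvd_mult dvd_mult2)
qed

lemma dvd_diff_power: "(d :: 'a::comm_ring_1) dvd x - y \<Longrightarrow> d dvd x ^ n - y ^ n"
  by (induction n) (auto intro: dvd_diff_mult)

lemma dvd_poly_diff: "x - y dvd poly f x - poly f (y :: 'a::comm_ring_1)"
  by (induction f) (auto intro: dvd_diff_mult)

lemma poly_padic_of_int: "poly_padic f (of_int x) = (of_int (poly f x) :: 'p::prime_card padic_int)"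
proof (induction f)
  case (pCons c f)
  then show ?case
    by (cases "f = 0 \<and> c = 0") (auto simp: map_poly_pCons)
qed simp

text \<open>
  Density of the natural numbers. Through it, statements about \<open>p\<close>-adic exponents modulo a power
  of \<open>p\<close> become statements about natural exponents.
\<close>

lemma near_nat:
  obtains n where "\<pi> ^ s dvd (z :: 'p::prime_card padic_int) - of_nat n"
proof
  have "0 \<le> residue z s mod int CARD('p) ^ s"
    using CARD_gt_1[where 'p = 'p] by (intro pos_mod_sign) simp
  then have "residue z s \<ge> 0"
    by (simp only: residue_mod)
  then show "\<pi> ^ s dvd z - of_nat (nat (residue z s))"
    by (simp add: uniformizer_power_dvd_diff_iff residue_of_int residue_mod)
qed

lemma padic_complete:
  fixes s :: "nat \<Rightarrow> 'p::prime_card padic_int"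
  assumes "\<And>m n. n \<ge> K m \<Longrightarrow> \<pi> ^ m dvd s (Suc n) - s n"
  obtains l where "\<And>m n. n \<ge> K m \<Longrightarrow> \<pi> ^ m dvd s n - l"
proof -
  let ?p = "int CARD('p)"
  have const: "residue (s n) m = residue (s (K m)) m" if "n \<ge> K m" for m n
    using that
  proof (induction n rule: dec_induct)
    case (step n)
    then show ?case using assms[of m n] by (simp add: uniformizer_power_dvd_diff_iff)
  qed simp
  define f where "f m = residue (s (K m)) m" for m
  have "f m = f (Suc m) mod ?p ^ m" for m
  proof -
    let ?n = "max (K m) (K (Suc m))"
    have "f m = residue (s ?n) m" "f (Suc m) = residue (s ?n) (Suc m)"
      unfolding f_def by (rule const[symmetric], simp)+
    then show ?thesis by (simp only: residue_Suc_mod)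
  qed
  then have res: "residue (Abs_padic_int f :: 'p padic_int) = f"
    by (intro Abs_padic_int_inverse) blast
  have "\<pi> ^ m dvd s n - Abs_padic_int f" if "n \<ge> K m" for m n
    using const[OF that] by (simp only: uniformizer_power_dvd_diff_iff res f_def)
  then show ?thesis by (rule that)
qed

lemma dist_le_if_power_dvd:
  assumes "\<pi> ^ m dvd x - (y :: 'p::prime_card padic_int)"
  shows "dist x y \<le> 1 / real CARD('p) ^ m"
proof (cases "x = y")
  case False
  then have "m \<le> Max {n. of_nat CARD('p) ^ n dvd x - y}"
    using assms power_dvd_padic_int_iff_le[of "x - y" m] by (simp add: uniformizer_def)
  then show ?thesis
    using False CARD_gt_1[where 'p = 'p] by (simp add: dist_padic_int_def frac_le)
qed (use CARD_gt_1[where 'p = 'p] in simp)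

lemma sums_if_power_dvd:
  fixes f :: "nat \<Rightarrow> 'p::prime_card padic_int"
  assumes "\<And>m n. n \<ge> K m \<Longrightarrow> \<pi> ^ m dvd sum f {..<n} - l"
  shows "f sums l"
  unfolding sums_def
proof (rule metric_LIMSEQ_I)
  fix r :: real assume "r > 0"
  moreover have "1 / real CARD('p) < 1" using CARD_gt_1[where 'p = 'p] by simp
  ultimately obtain m where m: "(1 / real CARD('p)) ^ m < r"
    using real_arch_pow_inv by blast
  have "dist (sum f {..<n}) l < r" if "n \<ge> K m" for n
    using dist_le_if_power_dvd[OF assms[OF that]] m by (simp add: power_one_over)
  then show "\<exists>no. \<forall>n\<ge>no. dist (sum f {..<n}) l < r" by blast
qed

text \<open>
  By the ultrametric inequality the tail of a series is as small as its largest term, so it is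
  enough to bound single terms, and the bound carries over to the value of the series.
\<close>

lemma suminf_cong:
  fixes f :: "nat \<Rightarrow> 'p::prime_card padic_int"
  assumes "\<And>m n. n \<ge> K m \<Longrightarrow> \<pi> ^ m dvd f n" and "n \<ge> K m"
  shows "\<pi> ^ m dvd suminf f - sum f {..<n}"
proof -
  have "\<pi> ^ m dvd sum f {..<Suc n} - sum f {..<n}" if "n \<ge> K m" for m n
    using assms(1)[OF that] by simp
  then obtain l where l: "\<And>m n. n \<ge> K m \<Longrightarrow> \<pi> ^ m dvd sum f {..<n} - l"
    using padic_complete[of K "\<lambda>n. sum f {..<n}"] by blast
  then have "suminf f = l"
    using sums_if_power_dvd sums_unique by metis
  with l[OF assms(2)] show ?thesis by (simp add: dvd_diff_sym)
qed

lemma contraction_fixed_point: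
  fixes f :: "'p::prime_card padic_int \<Rightarrow> 'p padic_int"
  assumes maps: "\<And>x. \<pi> ^ r dvd x - a \<Longrightarrow> \<pi> ^ r dvd f x - a"
    and contr: "\<And>s x y. s \<ge> r \<Longrightarrow> \<pi> ^ r dvd x - a \<Longrightarrow> \<pi> ^ r dvd y - a \<Longrightarrow>
      \<pi> ^ s dvd x - y \<Longrightarrow> \<pi> ^ Suc s dvd f x - f y"
  obtains x where "\<pi> ^ r dvd x - a" "f x = x"
proof -
  \<comment> \<open>The iterates start in the centre \<open>a\<close>, and the \<open>n\<close>-th step is divisible by \<open>\<pi>\<^sup>r\<^sup>+\<^sup>n\<close>.\<close>
  define s where "s n = (f ^^ n) a" for n
  have s_near: "\<pi> ^ r dvd s n - a" for n
    by (induction n) (auto simp: s_def maps)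
  have step: "\<pi> ^ (r + n) dvd s (Suc n) - s n" for n
  proof (induction n)
    case 0
    then show ?case using maps[of a] by (simp add: s_def)
  next
    case (Suc n)
    then show ?case using contr[OF _ s_near s_near, of "r + n" "Suc n" n] by (simp add: s_def)
  qed
  have "\<pi> ^ m dvd s (Suc n) - s n" if "n \<ge> m" for m n
    using step[of n] that by (meson dvd_trans le_imp_power_dvd trans_le_add2)
  then obtain l where l: "\<And>m n. n \<ge> m \<Longrightarrow> \<pi> ^ m dvd s n - l"
    using padic_complete[of "\<lambda>m. m" s] by blast
  have near: "\<pi> ^ r dvd l - a"
    using l[of r r] s_near[of r] by (metis dvd_diff_sym dvd_diff_trans order_refl)
  have "\<pi> ^ n dvd f l - l" for n
  proof -
    have "\<pi> ^ Suc (r + n) dvd f (s (r + n)) - f l"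
      using l by (intro contr s_near near) auto
    moreover have "\<pi> ^ Suc (r + n) dvd s (Suc (r + n)) - l"
      using l by blast
    ultimately have "\<pi> ^ Suc (r + n) dvd f l - l"
      by (simp add: s_def) (metis dvd_diff_sym dvd_diff_trans)
    moreover have "\<pi> ^ n dvd (\<pi> ^ Suc (r + n) :: 'p padic_int)"
      by (intro le_imp_power_dvd) simp
    ultimately show ?thesis by (rule dvd_trans[rotated])
  qed
  then have "f l = l" using eq_0_if_all_powers_dvd[of "f l - l"] by simp
  with near show ?thesis by (rule that)
qed

section \<open>The \<open>p\<close>-adic exponential and logarithm\<close>

abbreviation q_padic :: "'p::prime_card padic_int" (\<open>\<q>\<close>) where
  "\<q> \<equiv> of_nat (padic_q CARD('p))"

definition q_exponent :: "nat \<Rightarrow> nat" where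
  "q_exponent p = (if p = 2 then 2 else 1)"

lemma q_exponent_pos: "q_exponent p > 0"
  by (simp add: q_exponent_def)

lemma padic_q_eq: "padic_q p = p ^ q_exponent p"
  by (simp add: padic_q_def q_exponent_def)

lemma q_padic_eq: "(\<q> :: 'p::prime_card padic_int) = \<pi> ^ q_exponent CARD('p)"
  by (simp add: padic_q_eq uniformizer_def)

lemma uniformizer_dvd_q: "\<pi> dvd (\<q> :: 'p::prime_card padic_int)"
  unfolding q_padic_eq using q_exponent_pos by (simp add: dvd_power)

text \<open>
  Half of Legendre's formula: the multiples of \<open>p\<close> among \<open>1, \<dots>, n\<close> are \<open>p\<close> times
  \<open>1, \<dots>, n div p\<close>.
\<close>

lemma multiplicity_fact_step:
  assumes p: "prime (p :: nat)"
  shows "multiplicity p (fact n :: nat) = n div p + multiplicity p (fact (n div p) :: nat)"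
proof (induction n)
  case (Suc n)
  have mult: "multiplicity p (fact (Suc k) :: nat) = multiplicity p (Suc k) + multiplicity p (fact k :: nat)" for k
    using p by (simp only: fact_Suc of_nat_id) (intro prime_elem_multiplicity_mult_distrib, auto)
  show ?case
  proof (cases "p dvd Suc n")
    case True
    then obtain m where m: "Suc n = p * m" by (elim dvdE)
    then have "m > 0" by (cases m) auto
    then obtain k where k: "m = Suc k" by (cases m) auto
    have p1: "p > 1" using p by (rule prime_gt_1_nat)
    have "n = (p - 1) + k * p" using m k p1 by (simp add: algebra_simps)
    then have "n div p = k + (p - 1) div p" using p1 by (simp only: div_mult_self1)
    then have "n div p = k" using p1 by simp
    moreover have "Suc n div p = Suc k" using m k p1 by simp
    moreover have "multiplicity p (Suc n) = Suc (multiplicity p (Suc k))"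
      using m k p1 multiplicity_times_same[of "Suc k" p] p by simp
    ultimately show ?thesis
      using Suc.IH mult[of n] mult[of k] by simp
  next
    case False
    then have "Suc n div p = n div p"
      by (simp add: div_Suc dvd_eq_mod_eq_0)
    then show ?thesis
      using Suc.IH mult[of n] False by (simp add: not_dvd_imp_multiplicity_0)
  qed
qed simp

lemma multiplicity_fact_bound:
  assumes p: "prime (p :: nat)" and "n > 0"
  shows "(p - 1) * multiplicity p (fact n :: nat) \<le> n - 1"
  using \<open>n > 0\<close>
proof (induction n rule: less_induct)
  case (less n)
  have p1: "p > 1" using p by (rule prime_gt_1_nat)
  show ?case
  proof (cases "n div p = 0")
    case False
    let ?m = "n div p"
    have "?m < n" using p1 less.prems by simp
    then have "(p - 1) * multiplicity p (fact ?m :: nat) \<le> ?m - 1"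
      using less.IH[of ?m] False by simp
    then have "(p - 1) * multiplicity p (fact n :: nat) \<le> (p - 1) * ?m + (?m - 1)"
      by (subst multiplicity_fact_step[OF p]) (simp add: distrib_left)
    also have "\<dots> = p * ?m - 1"
      using p1 False by (simp add: algebra_simps diff_mult_distrib)
    also have "\<dots> \<le> n - 1"
      by (simp add: diff_le_mono)
    finally show ?thesis .
  next
    case True
    then show ?thesis using multiplicity_fact_step[OF p, of n] by simp
  qed
qed

text \<open>
  The estimate behind the convergence of both series. For odd \<open>p\<close> the multiplicity of \<open>p\<close> in
  \<open>i!\<close> is at most \<open>(i - 1) / 2\<close>, and for \<open>p = 2\<close> it is at most \<open>i - 1\<close> while \<open>q = p\<^sup>2\<close>. Either
  way at least \<open>i div 2\<close> factors \<open>p\<close> of \<open>q\<^sup>i\<^sup>-\<^sup>1\<close> remain.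
\<close>

lemma fact_dvd_q_power:
  assumes "i > 0"
  shows "fact i * \<pi> ^ (i div 2) dvd (\<q> :: 'p::prime_card padic_int) ^ (i - 1)"
proof -
  let ?p = "CARD('p)" and ?v = "multiplicity CARD('p) (fact i :: nat)"
  have bound: "(?p - 1) * ?v \<le> i - 1"
    using multiplicity_fact_bound[OF prime_card assms] .
  have "?v + i div 2 \<le> q_exponent ?p * (i - 1)"
  proof (cases "?p = 2")
    case True
    then have "?v \<le> i - 1" "i div 2 \<le> i - 1" using bound assms by auto
    then show ?thesis by (simp only: q_exponent_def True) simp
  next
    case False
    then have "2 \<le> ?p - 1" using CARD_gt_1[where 'p = 'p] by linarith
    then have "2 * ?v \<le> i - 1"
      using bound by (meson le_trans mult_le_mono1)
    then have "?v + i div 2 \<le> i - 1" by linarith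
    then show ?thesis by (simp only: q_exponent_def False) simp
  qed
  then have dvd: "\<pi> ^ (?v + i div 2) dvd (\<q> :: 'p padic_int) ^ (i - 1)"
    unfolding q_padic_eq power_mult[symmetric] by (rule le_imp_power_dvd)
  obtain m where m: "fact i = ?p ^ ?v * m" "\<not> ?p dvd m"
    using multiplicity_decompose'[of "fact i" ?p] prime_card[where 'a = 'p]
    by (metis fact_nonzero not_prime_unit)
  have "(fact i :: 'p padic_int) = of_nat (fact i)" by simp
  also have "\<dots> = \<pi> ^ ?v * of_nat m"
    by (subst m(1)) (simp add: uniformizer_def)
  finally have "fact i * \<pi> ^ (i div 2) = (\<pi> ^ (?v + i div 2) :: 'p padic_int) * of_nat m"
    by (simp add: power_add)
  moreover have "is_unit (of_nat m :: 'p padic_int)"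
    using m(2) by (simp add: unit_iff of_nat_dvd_iff)
  ultimately show ?thesis using dvd by (simp add: mult_unit_dvd_iff)
qed

text \<open>
  The exact quotients in \<open>Z\<^sub>p\<close> are the quotients in the fraction field. Setting one factor \<open>z\<close>
  aside makes the higher terms divisible by \<open>z\<close> and not merely by a fixed power of \<open>p\<close>.
\<close>

lemma exp_term_integral:
  assumes "\<q> dvd (z :: 'p::prime_card padic_int)"
  shows "fact i * (z ^ i / fact i) = z ^ i"
    and "i > 0 \<Longrightarrow> z * \<pi> ^ (i div 2) dvd z ^ i / fact i"
proof -
  have *: "fact i * (z ^ i / fact i) = z ^ i \<and> z * \<pi> ^ (i div 2) dvd z ^ i / fact i" if "i > 0"
  proof -
    from assms obtain y where y: "z = \<q> * y" by (elim dvdE)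
    from fact_dvd_q_power[OF that] obtain h :: "'p padic_int"
      where h: "\<q> ^ (i - 1) = fact i * \<pi> ^ (i div 2) * h" by (elim dvdE)
    have "z ^ i = z * z ^ (i - 1)" using that by (cases i) auto
    also have "z ^ (i - 1) = fact i * \<pi> ^ (i div 2) * h * y ^ (i - 1)"
      by (subst y) (simp only: power_mult_distrib h)
    also have "z * \<dots> = fact i * (z * \<pi> ^ (i div 2) * (h * y ^ (i - 1)))"
      by (simp only: mult_ac)
    finally show ?thesis by simp
  qed
  show "fact i * (z ^ i / fact i) = z ^ i"
    using * by (cases "i = 0") auto
  show "i > 0 \<Longrightarrow> z * \<pi> ^ (i div 2) dvd z ^ i / fact i"
    using * by blast
qed

lemma exp_term_small:
  assumes "\<q> dvd (z :: 'p::prime_card padic_int)" "i \<ge> 2 * m"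
  shows "\<pi> ^ m dvd z ^ i / fact i"
proof (cases "i = 0")
  case False
  have "\<pi> ^ m dvd (\<pi> ^ (i div 2) :: 'p padic_int)"
    using assms(2) by (intro le_imp_power_dvd) simp
  with exp_term_integral(2)[OF assms(1), of i] False show ?thesis
    by (meson dvd_mult dvd_trans gr0I)
qed (use assms in simp)

lemma padic_exp_cong:
  assumes "\<q> dvd (z :: 'p::prime_card padic_int)" "n \<ge> 2 * m"
  shows "\<pi> ^ m dvd padic_exp z - (\<Sum>i<n. z ^ i / fact i)"
  unfolding padic_exp_def
  by (rule suminf_cong[where K = "\<lambda>m. 2 * m"]) (use assms exp_term_small in auto)

lemma padic_exp_0 [simp]: "padic_exp (0 :: 'p::prime_card padic_int) = 1"
proof -
  have "(\<lambda>n. (0 :: 'p padic_int) ^ n / fact n) sums (\<Sum>n\<in>{0}. 0 ^ n / fact n)"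
    by (rule sums_finite) (auto simp: power_0_left)
  then show ?thesis by (simp add: padic_exp_def sums_iff)
qed

lemma exp_term_add:
  assumes "\<q> dvd (a :: 'p::prime_card padic_int)" "\<q> dvd b"
  shows "(a + b) ^ n / fact n = (\<Sum>i\<le>n. (a ^ i / fact i) * (b ^ (n - i) / fact (n - i)))"
proof -
  let ?t = "\<lambda>z i. z ^ i / (fact i :: 'p padic_int)"
  have "fact n * (?t (a + b) n) = (a + b) ^ n"
    using assms by (intro exp_term_integral) (rule dvd_add)
  also have "\<dots> = (\<Sum>i\<le>n. of_nat (n choose i) * a ^ i * b ^ (n - i))"
    by (rule binomial_ring)
  also have "\<dots> = (\<Sum>i\<le>n. fact n * (?t a i * ?t b (n - i)))"
  proof (rule sum.cong)
    fix i assume i: "i \<in> {..n}"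
    have "of_nat (n choose i) * a ^ i * b ^ (n - i) =
        of_nat (n choose i) * (fact i * ?t a i) * (fact (n - i) * ?t b (n - i))"
      by (simp only: exp_term_integral(1)[OF assms(1)] exp_term_integral(1)[OF assms(2)])
    also have "\<dots> = of_nat (fact i * fact (n - i) * (n choose i)) * (?t a i * ?t b (n - i))"
      by (simp add: mult_ac)
    also have "fact i * fact (n - i) * (n choose i) = fact n"
      using i by (intro binomial_fact_lemma) simp
    finally show "of_nat (n choose i) * a ^ i * b ^ (n - i) = fact n * (?t a i * ?t b (n - i))"
      by simp
  qed simp
  also have "\<dots> = fact n * (\<Sum>i\<le>n. ?t a i * ?t b (n - i))"
    by (simp only: sum_distrib_left)
  finally show ?thesis by simp
qed

lemma padic_exp_add:
  assumes a: "\<q> dvd (a :: 'p::prime_card padic_int)" and b: "\<q> dvd b"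
  shows "padic_exp (a + b) = padic_exp a * padic_exp b"
proof -
  let ?t = "\<lambda>z i. z ^ i / (fact i :: 'p padic_int)"
  have "\<pi> ^ m dvd padic_exp (a + b) - padic_exp a * padic_exp b" for m
  proof -
    \<comment> \<open>A product of terms outside the triangle has an index of at least \<open>2 m\<close>.\<close>
    let ?K = "4 * m" and ?T = "{(i, j). i + j < 4 * m}"
    have "(\<Sum>n<?K. ?t (a + b) n) = (\<Sum>n<?K. \<Sum>i\<le>n. ?t a i * ?t b (n - i))"
      by (simp only: exp_term_add[OF a b])
    also have "\<dots> = (\<Sum>(i, j)\<in>?T. ?t a i * ?t b j)"
      by (rule sum.triangle_reindex[symmetric])
    finally have e: "(\<Sum>n<?K. ?t (a + b) n) = (\<Sum>(i, j)\<in>?T. ?t a i * ?t b j)" .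
    let ?S = "{..<?K} \<times> {..<?K}" and ?f = "\<lambda>(i, j). ?t a i * ?t b j"
    have prod: "(\<Sum>i<?K. ?t a i) * (\<Sum>j<?K. ?t b j) = sum ?f ?S"
      by (subst sum_product) (rule sum.cartesian_product)
    have sub: "?T \<subseteq> ?S" by auto
    have small: "\<pi> ^ m dvd ?f ij" if ij: "ij \<in> ?S - ?T" for ij
    proof -
      obtain i j where [simp]: "ij = (i, j)" by (rule prod.exhaust)
      from ij have "i \<ge> 2 * m \<or> j \<ge> 2 * m" by auto
      then have "\<pi> ^ m dvd ?t a i \<or> \<pi> ^ m dvd ?t b j"
        using exp_term_small[OF a] exp_term_small[OF b] by blast
      then have "\<pi> ^ m dvd ?t a i * ?t b j"
        by (rule disjE) (rule dvd_mult2, assumption, rule dvd_mult, assumption)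
      then show ?thesis by simp
    qed
    have "sum ?f ?S - sum ?f ?T = sum ?f (?S - ?T)"
      by (rule sum_diff[symmetric]) (use sub in auto)
    also have "\<pi> ^ m dvd \<dots>"
      by (rule dvd_sum) (rule small)
    finally have "\<pi> ^ m dvd sum ?f ?T - sum ?f ?S"
      by (rule dvd_diff_sym[THEN iffD1])
    then have "\<pi> ^ m dvd (\<Sum>n<?K. ?t (a + b) n) - (\<Sum>i<?K. ?t a i) * (\<Sum>j<?K. ?t b j)"
      by (simp only: e prod)
    moreover have "\<pi> ^ m dvd padic_exp (a + b) - (\<Sum>n<?K. ?t (a + b) n)"
      using a b by (intro padic_exp_cong dvd_add) auto
    moreover have "\<pi> ^ m dvd (\<Sum>i<?K. ?t a i) * (\<Sum>j<?K. ?t b j) - padic_exp a * padic_exp b"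
      by (rule dvd_diff_mult; subst dvd_diff_sym; intro padic_exp_cong a b) simp_all
    ultimately show ?thesis by (blast intro: dvd_diff_trans)
  qed
  then show ?thesis using eq_0_if_all_powers_dvd[of "padic_exp (a + b) - padic_exp a * padic_exp b"]
    by simp
qed

lemma padic_exp_of_nat_mult:
  assumes "\<q> dvd (a :: 'p::prime_card padic_int)"
  shows "padic_exp (of_nat n * a) = padic_exp a ^ n"
  by (induction n) (use assms in \<open>auto simp: distrib_right padic_exp_add\<close>)

lemma padic_exp_cong_1:
  assumes "\<pi> ^ s dvd z" "\<q> dvd (z :: 'p::prime_card padic_int)"
  shows "\<pi> ^ s dvd padic_exp z - 1"
proof -
  let ?t = "\<lambda>i. z ^ i / fact i"
  have exp: "\<pi> ^ s dvd padic_exp z - sum ?t {..<Suc (2 * s)}"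
    using assms(2) by (intro padic_exp_cong) simp_all
  have sum: "sum ?t {..<Suc (2 * s)} - 1 = (\<Sum>i<2 * s. ?t (Suc i))"
    by (subst sum.lessThan_Suc_shift) simp
  have "\<pi> ^ s dvd ?t (Suc i)" for i
    using exp_term_integral(2)[OF assms(2), of "Suc i"] assms(1)
    by (blast intro: dvd_mult_left dvd_trans)
  then have "\<pi> ^ s dvd sum ?t {..<Suc (2 * s)} - 1"
    unfolding sum by (intro dvd_sum)
  with exp show ?thesis by (rule dvd_diff_trans)
qed

text \<open>
  Let \<open>N = p\<^sup>t\<close>. For \<open>j > 1\<close> the \<open>j\<close>-th term of \<open>exp(N z)\<close> is \<open>N\<^sup>j\<close> times the \<open>j\<close>-th term of \<open>exp(z)\<close>, which is
  integral.
\<close>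

lemma padic_exp_cong_2:
  assumes "\<q> dvd (z :: 'p::prime_card padic_int)"
  shows "\<pi> ^ (2 * t) dvd padic_exp (\<pi> ^ t * z) - (1 + \<pi> ^ t * z)"
proof -
  let ?w = "\<pi> ^ t * z" and ?n = "Suc (Suc (4 * t))"
  have w: "\<q> dvd ?w" using assms by simp
  let ?t = "\<lambda>i. ?w ^ i / fact i"
  have exp: "\<pi> ^ (2 * t) dvd padic_exp ?w - sum ?t {..<?n}"
    using w by (intro padic_exp_cong) simp_all
  have sum: "sum ?t {..<?n} - (1 + ?w) = (\<Sum>i<4 * t. ?t (Suc (Suc i)))"
    by (subst sum.lessThan_Suc_shift, subst sum.lessThan_Suc_shift) simp
  have "\<pi> ^ (2 * t) dvd ?t (Suc (Suc i))" for i
  proof -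
    let ?j = "Suc (Suc i)"
    have "fact ?j * ?t ?j = ?w ^ ?j"
      by (rule exp_term_integral(1)[OF w])
    also have "\<dots> = \<pi> ^ (t * ?j) * z ^ ?j"
      by (simp only: power_mult_distrib power_mult)
    also have "\<dots> = \<pi> ^ (t * ?j) * (fact ?j * (z ^ ?j / fact ?j))"
      by (simp only: exp_term_integral(1)[OF assms])
    also have "\<dots> = fact ?j * (\<pi> ^ (t * ?j) * (z ^ ?j / fact ?j))"
      by (rule mult.left_commute)
    finally have "?t ?j = \<pi> ^ (t * ?j) * (z ^ ?j / fact ?j)"
      using fact_nonzero mult_left_cancel by blast
    moreover have "\<pi> ^ (2 * t) dvd (\<pi> ^ (t * ?j) :: 'p padic_int)"
      by (intro le_imp_power_dvd) simp
    ultimately show ?thesis by (simp only: dvd_mult2)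
  qed
  then have "\<pi> ^ (2 * t) dvd sum ?t {..<?n} - (1 + ?w)"
    unfolding sum by (intro dvd_sum)
  with exp show ?thesis by (rule dvd_diff_trans)
qed

lemma binomial_times_fact_Suc:
  assumes "n > 0"
  shows "(n choose Suc i) * fact (Suc i) = n * ((n - 1 choose i) * fact i)"
proof -
  have "(n choose Suc i) * fact (Suc i) = (Suc i * (n choose Suc i)) * fact i"
    by (simp only: fact_Suc of_nat_id mult_ac)
  also have "\<dots> = n * ((n - 1 choose i) * fact i)"
    by (simp only: binomial_absorption mult_ac)
  finally show ?thesis .
qed

lemma binomial_term:
  assumes "\<q> dvd (d :: 'p::prime_card padic_int)" "n > 0"
  shows "of_nat (n choose Suc i) * d ^ Suc i
    = of_nat n * (of_nat ((n - 1 choose i) * fact i) * (d ^ Suc i / fact (Suc i)))"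
proof -
  have "of_nat (n choose Suc i) * d ^ Suc i
      = of_nat (n choose Suc i) * (fact (Suc i) * (d ^ Suc i / fact (Suc i)))"
    by (simp only: exp_term_integral(1)[OF assms(1)])
  also have "\<dots> = of_nat ((n choose Suc i) * fact (Suc i)) * (d ^ Suc i / fact (Suc i))"
    by (simp only: of_nat_mult of_nat_fact mult.assoc)
  also have "\<dots> = of_nat (n * ((n - 1 choose i) * fact i)) * (d ^ Suc i / fact (Suc i))"
    by (simp only: binomial_times_fact_Suc[OF assms(2)])
  finally show ?thesis by (simp only: of_nat_mult mult.assoc)
qed

text \<open>
  The \<open>j\<close>-th term of the binomial expansion is \<open>n d\<close> times an integer multiple of
  \<open>d\<^sup>j\<^sup>-\<^sup>1 / j!\<close>, and for \<open>j > 1\<close> the latter is divisible by \<open>p\<close>.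
\<close>

lemma one_plus_power_cong:
  assumes "\<q> dvd (d :: 'p::prime_card padic_int)"
  shows "of_nat n * d * \<pi> dvd (1 + d) ^ n - (1 + of_nat n * d)"
proof (cases n)
  case (Suc m)
  let ?f = "\<lambda>j. of_nat (n choose j) * d ^ j"
  have "(1 + d) ^ n = (\<Sum>j<Suc (Suc m). ?f j)"
    using binomial_ring[of d 1 n] by (simp add: Suc lessThan_Suc_atMost add.commute)
  also have "\<dots> = (1 + of_nat n * d) + (\<Sum>i<m. ?f (Suc (Suc i)))"
    by (subst sum.lessThan_Suc_shift, subst sum.lessThan_Suc_shift) (simp add: Suc)
  finally have "(1 + d) ^ n - (1 + of_nat n * d) = (\<Sum>i<m. ?f (Suc (Suc i)))" by simp
  moreover have "of_nat n * d * \<pi> dvd ?f (Suc (Suc i))" for i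
  proof -
    have "d * \<pi> dvd d * \<pi> ^ (Suc (Suc i) div 2)"
      by (intro mult_dvd_mono dvd_power) simp_all
    also have "\<dots> dvd d ^ Suc (Suc i) / fact (Suc (Suc i))"
      by (rule exp_term_integral(2)[OF assms]) simp
    finally have "d * \<pi> dvd d ^ Suc (Suc i) / fact (Suc (Suc i))" .
    moreover have "n > 0" by (simp add: Suc)
    ultimately show ?thesis
      unfolding binomial_term[OF assms \<open>n > 0\<close>] mult.assoc
      by (intro mult_dvd_mono dvd_refl dvd_mult)
  qed
  ultimately show ?thesis by (simp only: dvd_sum)
qed simp

text \<open>
  On \<open>1 + q Z\<^sub>p\<close> the \<open>n\<close>-th power moves a point away from \<open>1\<close> by the factor \<open>n\<close> up to a unit; so
  \<open>n\<close>-th roots in \<open>1 + q Z\<^sub>p\<close> are unique and can be extracted with a controlled loss of precision.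
\<close>

corollary one_plus_power_eq:
  assumes "\<q> dvd (d :: 'p::prime_card padic_int)"
  obtains c where "is_unit c" "(1 + d) ^ n - 1 = of_nat n * d * c"
proof -
  from one_plus_power_cong[OF assms, of n] obtain h
    where h: "(1 + d) ^ n - (1 + of_nat n * d) = of_nat n * d * \<pi> * h" by (elim dvdE)
  have "(1 + d) ^ n - 1 = ((1 + d) ^ n - (1 + of_nat n * d)) + of_nat n * d" by simp
  also have "\<dots> = of_nat n * d * (1 + \<pi> * h)"
    unfolding h by (simp add: algebra_simps)
  finally have "(1 + d) ^ n - 1 = of_nat n * d * (1 + \<pi> * h)" .
  moreover have "is_unit (1 + \<pi> * h)"
    by (rule unit_if_near_unit[of _ 1]) simp_all
  ultimately show ?thesis by (rule that[rotated])
qed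

text \<open>
  The terms of the logarithm are multiples of those of the exponential series, from which they
  inherit integrality and smallness.
\<close>

lemma log_term_eq:
  assumes "\<q> dvd (d :: 'p::prime_card padic_int)"
  shows "d ^ Suc n / of_nat (Suc n) = fact n * (d ^ Suc n / fact (Suc n))"
proof -
  have "d ^ Suc n = fact (Suc n) * (d ^ Suc n / fact (Suc n))"
    by (rule exp_term_integral(1)[OF assms, symmetric])
  also have "\<dots> = of_nat (Suc n) * (fact n * (d ^ Suc n / fact (Suc n)))"
    by (simp only: fact_Suc mult.assoc)
  finally show ?thesis
    by (metis nonzero_mult_div_cancel_left of_nat_neq_0)
qed

lemma log_term_dvd:
  assumes "\<q> dvd (d :: 'p::prime_card padic_int)"
  shows "d * \<pi> ^ (Suc n div 2) dvd (- 1) ^ n * (d ^ Suc n / of_nat (Suc n))"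
  unfolding log_term_eq[OF assms]
  by (intro dvd_mult exp_term_integral(2)[OF assms]) simp

lemma padic_log_cong:
  assumes "\<q> dvd (u :: 'p::prime_card padic_int) - 1" "n \<ge> 2 * m"
  shows "\<pi> ^ m dvd padic_log u - (\<Sum>n<n. (- 1) ^ n * ((u - 1) ^ Suc n / of_nat (Suc n)))"
  unfolding padic_log_def
proof (rule suminf_cong[where K = "\<lambda>m. 2 * m"])
  fix m n :: nat assume "n \<ge> 2 * m"
  then have "\<pi> ^ m dvd (\<pi> ^ (Suc n div 2) :: 'p padic_int)"
    by (intro le_imp_power_dvd) simp
  then have "\<pi> ^ m dvd (u - 1) * \<pi> ^ (Suc n div 2)"
    by (rule dvd_mult)
  then show "\<pi> ^ m dvd (- 1) ^ n * ((u - 1) ^ Suc n / of_nat (Suc n))"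
    using log_term_dvd[OF assms(1)] by (rule dvd_trans)
qed (use assms in simp)

lemma q_dvd_padic_log:
  assumes "\<q> dvd (u :: 'p::prime_card padic_int) - 1"
  shows "\<q> dvd padic_log u"
proof -
  let ?f = "\<lambda>n. (- 1) ^ n * ((u - 1) ^ Suc n / of_nat (Suc n))"
  let ?s = "sum ?f {..<2 * q_exponent CARD('p)}"
  have "\<q> dvd ?f n" for n
    using log_term_dvd[OF assms, of n] assms by (blast intro: dvd_mult_left dvd_trans)
  then have "\<q> dvd ?s" by (intro dvd_sum)
  moreover have "\<q> dvd padic_log u - ?s"
    unfolding q_padic_eq by (intro padic_log_cong assms) simp
  ultimately have "\<q> dvd (padic_log u - ?s) + ?s" by (intro dvd_add)
  then show ?thesis by simp
qed

lemma binomial_pred_cong: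
  assumes "i < n"
  shows "of_nat n dvd of_nat ((n - 1 choose i) * fact i) - (- 1) ^ i * (fact i :: 'a::{comm_ring_1, semiring_char_0})"
  using assms
proof (induction i)
  case (Suc i)
  have "(n - 1 choose Suc i) * fact (Suc i) = (Suc i * (n - 1 choose Suc i)) * fact i"
    by (simp only: fact_Suc of_nat_id mult_ac)
  also have "Suc i * (n - 1 choose Suc i) = (n - 1 - i) * (n - 1 choose i)"
    by (simp only: binomial_absorption binomial_absorb_comp)
  finally have e: "(n - 1 choose Suc i) * fact (Suc i) = (n - Suc i) * ((n - 1 choose i) * fact i)"
    by (simp add: mult_ac)
  have "of_nat n dvd of_nat (n - Suc i) * of_nat ((n - 1 choose i) * fact i)
      - (- of_nat (Suc i)) * ((- 1) ^ i * fact i :: 'a)"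
    by (rule dvd_diff_mult) (use Suc in \<open>simp_all add: of_nat_diff\<close>)
  also have "(- of_nat (Suc i)) * ((- 1) ^ i * fact i :: 'a) = (- 1) ^ Suc i * fact (Suc i)"
    by (simp only: fact_Suc power_Suc mult_minus_left mult_minus_right mult_1_left mult.left_commute)
  finally show ?case by (simp only: e of_nat_mult)
qed simp

text \<open>
  In the expansion of \<open>u\<^sup>N - 1\<close> the coefficient of \<open>(u - 1)\<^sup>j\<close> is \<open>N/j\<close> times the binomial coefficient
  of \<open>N - 1\<close> over \<open>j - 1\<close>, and the latter is \<open>\<plusminus>1\<close> up to a multiple of \<open>N\<close> over \<open>(j - 1)!\<close>.
\<close>

lemma power_minus_1_cong_log:
  assumes "\<q> dvd (u :: 'p::prime_card padic_int) - 1"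
  shows "\<pi> ^ (2 * t) dvd (u ^ (CARD('p) ^ t) - 1) - \<pi> ^ t * padic_log u"
proof -
  let ?N = "CARD('p) ^ t" and ?d = "u - 1"
  let ?b = "\<lambda>i. of_nat (?N choose i) * ?d ^ i"
  let ?l = "\<lambda>i. (- 1) ^ i * (?d ^ Suc i / of_nat (Suc i))"
  have N: "?N > 0" "(of_nat ?N :: 'p padic_int) = \<pi> ^ t"
    using CARD_gt_1[where 'p = 'p] by (simp_all add: uniformizer_def)
  \<comment> \<open>\<open>N\<close> terms are enough to determine the logarithm modulo \<open>\<pi>\<^sup>t = N\<close>.\<close>
  have "2 * t \<le> 2 ^ t"
  proof (induction t)
    case (Suc t)
    then show ?case by (cases t) auto
  qed simp
  also have "(2 :: nat) ^ t \<le> ?N" using CARD_gt_1[where 'p = 'p] by (intro power_mono) auto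
  finally have "2 * t \<le> ?N" .
  then have log: "\<pi> ^ t dvd padic_log u - sum ?l {..<?N}"
    by (rule padic_log_cong[OF assms])
  have "u ^ ?N = (?d + 1) ^ ?N" by simp
  also have "\<dots> = (\<Sum>j<Suc ?N. ?b j)"
    by (subst binomial_ring) (simp add: lessThan_Suc_atMost)
  finally have pow: "u ^ ?N - 1 = (\<Sum>i<?N. ?b (Suc i))"
    by (simp only: sum.lessThan_Suc_shift) simp
  have "\<pi> ^ (2 * t) dvd ?b (Suc i) - \<pi> ^ t * ?l i" if "i < ?N" for i
  proof -
    let ?e = "?d ^ Suc i / fact (Suc i)"
    have "?b (Suc i) - \<pi> ^ t * ?l i = \<pi> ^ t * (of_nat ((?N - 1 choose i) * fact i) * ?e)
        - \<pi> ^ t * ((- 1) ^ i * (fact i * ?e))"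
      by (simp only: binomial_term[OF assms N(1)] log_term_eq[OF assms] N(2))
    also have "\<dots> = \<pi> ^ t * (of_nat ((?N - 1 choose i) * fact i) - (- 1) ^ i * fact i) * ?e"
      by (simp only: left_diff_distrib right_diff_distrib mult.assoc)
    finally have e: "?b (Suc i) - \<pi> ^ t * ?l i = \<dots>" .
    have "\<pi> ^ t * \<pi> ^ t dvd \<pi> ^ t * (of_nat ((?N - 1 choose i) * fact i) - (- 1) ^ i * fact i :: 'p padic_int)"
      using binomial_pred_cong[OF that, where 'a = "'p padic_int"] unfolding N(2)
      by (rule mult_dvd_mono[OF dvd_refl])
    then show ?thesis unfolding e mult_2 power_add by (rule dvd_mult2)
  qed
  then have "\<pi> ^ (2 * t) dvd (\<Sum>i<?N. ?b (Suc i) - \<pi> ^ t * ?l i)"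
    by (intro dvd_sum) simp
  then have "\<pi> ^ (2 * t) dvd (u ^ ?N - 1) - \<pi> ^ t * sum ?l {..<?N}"
    by (simp only: pow sum_subtractf sum_distrib_left)
  moreover have "\<pi> ^ (2 * t) dvd \<pi> ^ t * sum ?l {..<?N} - \<pi> ^ t * padic_log u"
  proof -
    have "\<pi> ^ t * \<pi> ^ t dvd \<pi> ^ t * (sum ?l {..<?N} - padic_log u)"
      using log by (intro mult_dvd_mono dvd_refl) (rule dvd_diff_sym[THEN iffD1])
    then show ?thesis by (simp only: mult_2 power_add right_diff_distrib)
  qed
  ultimately show ?thesis by (rule dvd_diff_trans)
qed

text \<open>
  For \<open>N = p\<^sup>t\<close> one has \<open>exp(log u)\<^sup>N = exp(N log u) \<equiv> 1 + N log u \<equiv> u\<^sup>N\<close> modulo \<open>N\<^sup>2\<close>. Taking an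
  \<open>N\<close>-th root costs a factor \<open>N\<close> only, so \<open>exp(log u) \<equiv> u\<close> modulo \<open>N\<close>.
\<close>

lemma padic_exp_log:
  assumes u: "\<q> dvd (u :: 'p::prime_card padic_int) - 1"
  shows "padic_exp (padic_log u) = u"
proof -
  define w where "w = padic_exp (padic_log u)"
  note log = q_dvd_padic_log[OF u]
  have w: "\<q> dvd w - 1"
    unfolding w_def q_padic_eq
    by (intro padic_exp_cong_1) (use log in \<open>simp_all add: q_padic_eq\<close>)
  have "is_unit u"
    using u uniformizer_dvd_q dvd_trans by (intro unit_if_near_unit[of u 1]) auto
  then obtain v where v: "u * v = 1" by (auto elim: dvdE)
  define d where "d = w * v - 1"
  have "d = ((w - 1) - (u - 1)) * v" using v by (simp add: d_def algebra_simps)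
  then have d: "\<q> dvd d" using dvd_diff[OF w u] by (simp only: dvd_mult2)
  have "\<pi> ^ t dvd d" for t
  proof -
    let ?N = "CARD('p) ^ t"
    have N: "(of_nat ?N :: 'p padic_int) = \<pi> ^ t" by (simp add: uniformizer_def)
    have "w ^ ?N = padic_exp (\<pi> ^ t * padic_log u)"
      unfolding w_def N[symmetric] by (rule padic_exp_of_nat_mult[OF log, symmetric])
    then have "\<pi> ^ (2 * t) dvd w ^ ?N - (1 + \<pi> ^ t * padic_log u)"
      using padic_exp_cong_2[OF log, of t] by simp
    moreover have "\<pi> ^ (2 * t) dvd (1 + \<pi> ^ t * padic_log u) - u ^ ?N"
      using power_minus_1_cong_log[OF u, of t] by (subst dvd_diff_sym) (simp add: algebra_simps)
    ultimately have "\<pi> ^ (2 * t) dvd w ^ ?N - u ^ ?N" by (rule dvd_diff_trans)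
    then have "\<pi> ^ (2 * t) dvd (w ^ ?N - u ^ ?N) * v ^ ?N" by (rule dvd_mult2)
    also have "(w ^ ?N - u ^ ?N) * v ^ ?N = (w * v) ^ ?N - (u * v) ^ ?N"
      by (simp only: left_diff_distrib power_mult_distrib)
    also have "\<dots> = (1 + d) ^ ?N - 1"
      unfolding v by (simp add: d_def)
    finally have "\<pi> ^ (2 * t) dvd (1 + d) ^ ?N - 1" .
    moreover obtain c where c: "is_unit c" "(1 + d) ^ ?N - 1 = of_nat ?N * d * c"
      by (rule one_plus_power_eq[OF d])
    ultimately have "\<pi> ^ t * \<pi> ^ t dvd \<pi> ^ t * d * c"
      by (simp only: N mult_2 power_add)
    then have "\<pi> ^ t * \<pi> ^ t dvd \<pi> ^ t * d"
      using c(1) by (simp add: dvd_mult_unit_iff)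
    then show ?thesis by simp
  qed
  then have "d = 0" by (rule eq_0_if_all_powers_dvd)
  then have "w * v = 1" by (simp add: d_def)
  with v have "w = u" by (metis mult.assoc mult.commute mult_1)
  then show ?thesis by (simp add: w_def)
qed

section \<open>Powers with \<open>p\<close>-adic and with negative exponents\<close>

lemma unit_mult_inverse: "is_unit x \<Longrightarrow> x * inverse (x :: 'p::prime_card padic_int) = 1"
  by (simp add: inverse_padic_int_def)

text \<open>
  With \<open>n = i - j\<close> an integer power of a unit is characterised by an equation between natural
  powers, which spares all later arguments a distinction by the sign of the exponent.
\<close>

lemma powi_unit_eq:
  assumes "is_unit (x :: 'p::prime_card padic_int)"
  shows "x powi (int i - int j) * x ^ j = x ^ i"
proof (cases "i \<ge> j")
  case True
  then have "x powi (int i - int j) = x ^ (i - j)" by (simp add: power_int_def nat_diff_distrib)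
  with True show ?thesis by (simp flip: power_add)
next
  case False
  then have "x powi (int i - int j) = inverse x ^ (j - i)" by (simp add: power_int_def nat_diff_distrib)
  moreover have "x ^ j = x ^ (j - i) * x ^ i" using False by (simp flip: power_add)
  moreover have "inverse x ^ (j - i) * x ^ (j - i) = 1"
    using unit_mult_inverse[OF assms] by (simp add: mult.commute flip: power_mult_distrib)
  ultimately show ?thesis by (simp add: mult.assoc[symmetric])
qed

lemma powi_unit_eqI:
  assumes "is_unit (x :: 'p::prime_card padic_int)" "y * x ^ j = x ^ i"
  shows "y = x powi (int i - int j)"
proof -
  have "x \<noteq> 0" using assms(1) by auto
  moreover have "y * x ^ j = x powi (int i - int j) * x ^ j"
    using powi_unit_eq[OF assms(1)] assms(2) by simp
  ultimately show ?thesis by simp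
qed

lemma int_as_diff: obtains i j where "n = int i - int j"
  by (rule that[of "nat n" "nat (- n)"]) simp

lemma powi_mult_distrib:
  assumes "is_unit (x :: 'p::prime_card padic_int)" "is_unit y"
  shows "(x * y) powi n = x powi n * y powi n"
proof -
  obtain i j where n: "n = int i - int j" by (rule int_as_diff)
  have "(x powi n * y powi n) * (x * y) ^ j = (x powi n * x ^ j) * (y powi n * y ^ j)"
    by (simp add: power_mult_distrib mult_ac)
  also have "\<dots> = (x * y) ^ i"
    by (simp add: n powi_unit_eq assms power_mult_distrib)
  finally show ?thesis
    unfolding n using assms by (intro powi_unit_eqI[symmetric]) auto
qed

lemma powi_periodic:
  assumes "w ^ m = (1 :: 'p::prime_card padic_int)" "m > 0" "[n = n'] (mod int m)"
  shows "w powi n = w powi n'"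
proof -
  have w: "is_unit w" using assms(1,2) by (metis dvd_power dvd_trans dvd_refl)
  obtain k where k: "n = n' + int m * k" using assms(3) cong_iff_lin by (metis add.commute cong_sym mult.commute)
  obtain i j where n': "n' = int i - int j" by (rule int_as_diff)
  obtain a b where ab: "k = int a - int b" by (rule int_as_diff)
  have "w powi n' * w ^ (j + m * b) = w ^ (i + m * a)"
    using powi_unit_eq[OF w, of i j] assms(1)
    by (simp add: power_add power_mult n')
  then have "w powi n' = w powi (int (i + m * a) - int (j + m * b))"
    by (rule powi_unit_eqI[OF w])
  also have "int (i + m * a) - int (j + m * b) = n"
    by (simp add: k n' ab algebra_simps)
  finally show ?thesis by simp
qed

text \<open>
  The function \<open>u\<^sup>z\<close> of two variables, of which \<open>one_unit_power x z\<close> is the value at the one-unit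
  part \<open>u\<close> of \<open>x\<close>.
\<close>

definition one_unit_powr :: "'p::prime_card padic_int \<Rightarrow> 'p padic_int \<Rightarrow> 'p padic_int" where
  "one_unit_powr u z = padic_exp (z * padic_log u)"

context
  fixes u :: "'p::prime_card padic_int"
  assumes u: "\<q> dvd u - 1"
begin

lemma one_unit_powr_add: "one_unit_powr u (y + z) = one_unit_powr u y * one_unit_powr u z"
  using q_dvd_padic_log[OF u] by (simp add: one_unit_powr_def distrib_right padic_exp_add)

lemma one_unit_powr_of_nat: "one_unit_powr u (of_nat n) = u ^ n"
  using q_dvd_padic_log[OF u]
  by (simp add: one_unit_powr_def padic_exp_of_nat_mult padic_exp_log[OF u])

lemma one_unit_powr_of_int: "one_unit_powr u (of_int n) = u powi n"
proof -
  obtain i j where n: "n = int i - int j" by (rule int_as_diff)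
  have "is_unit u"
    using u uniformizer_dvd_q dvd_trans by (intro unit_if_near_unit[of u 1]) auto
  moreover have "one_unit_powr u (of_int n) * u ^ j = u ^ i"
    by (simp add: n flip: one_unit_powr_of_nat one_unit_powr_add)
  ultimately show ?thesis unfolding n by (rule powi_unit_eqI)
qed

text \<open>
  The extra factor \<open>p\<close>, compared with the exponent, comes from \<open>log u\<close>. It makes the dependence on
  the exponent invisible in derivatives modulo \<open>p\<close>.
\<close>

lemma one_unit_powr_small:
  assumes "\<pi> ^ s dvd z"
  shows "\<pi> ^ Suc s dvd one_unit_powr u z - 1"
  unfolding one_unit_powr_def
proof (rule padic_exp_cong_1)
  have "\<pi> ^ s * \<pi> dvd z * padic_log u"
    using assms uniformizer_dvd_q q_dvd_padic_log[OF u] by (intro mult_dvd_mono) (auto intro: dvd_trans)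
  then show "\<pi> ^ Suc s dvd z * padic_log u" by (simp add: mult.commute)
qed (use q_dvd_padic_log[OF u] in simp)

lemma one_unit_powr_near_1: "\<q> dvd one_unit_powr u z - 1"
  unfolding one_unit_powr_def q_padic_eq
  by (rule padic_exp_cong_1) (use q_dvd_padic_log[OF u] in \<open>simp_all add: q_padic_eq\<close>)

lemma one_unit_powr_cong:
  assumes "\<pi> ^ s dvd z - z'"
  shows "\<pi> ^ Suc s dvd one_unit_powr u z - one_unit_powr u z'"
proof -
  have "one_unit_powr u z - one_unit_powr u z' = one_unit_powr u z' * (one_unit_powr u (z - z') - 1)"
    by (simp add: right_diff_distrib flip: one_unit_powr_add)
  with one_unit_powr_small[OF assms] show ?thesis by simp
qed

end

text \<open>
  The derivative of \<open>u\<^sup>z\<close> in the base. Modulo a power of \<open>p\<close> the exponent may be taken to be a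
  natural number, which reduces the claim to the binomial expansion.
\<close>

lemma one_unit_powr_base_cong:
  assumes u: "\<q> dvd u - (1 :: 'p::prime_card padic_int)" and d: "\<q> dvd d" "\<pi> ^ s dvd d"
  shows "\<pi> ^ Suc s dvd one_unit_powr (u * (1 + d)) z - one_unit_powr u z * (1 + z * d)"
proof -
  obtain n where n: "\<pi> ^ Suc s dvd z - of_nat n" by (rule near_nat)
  have ud: "\<q> dvd u * (1 + d) - 1"
    using dvd_diff_mult[OF u, of "1 + d" 1] d by simp
  have weaken: "\<pi> ^ Suc s dvd x" if "\<pi> ^ Suc (Suc s) dvd x" for x :: "'p padic_int"
    using that by (meson dvd_trans le_SucI le_imp_power_dvd order_refl)
  have "\<pi> ^ Suc s dvd one_unit_powr (u * (1 + d)) z - (u * (1 + d)) ^ n"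
    using weaken[OF one_unit_powr_cong[OF ud n]] by (simp only: one_unit_powr_of_nat[OF ud])
  moreover have "\<pi> ^ Suc s dvd (u * (1 + d)) ^ n - one_unit_powr u z * (1 + z * d)"
  proof -
    have "\<pi> ^ Suc s dvd u ^ n - one_unit_powr u z"
      using weaken[OF one_unit_powr_cong[OF u n]]
      by (simp only: one_unit_powr_of_nat[OF u] dvd_diff_sym[of _ "u ^ n"])
    moreover have "\<pi> ^ Suc s dvd (1 + d) ^ n - (1 + z * d)"
    proof (rule dvd_diff_trans)
      have "\<pi> ^ s * \<pi> dvd of_nat n * d * \<pi>"
        using d by (intro mult_dvd_mono) simp_all
      also have "\<dots> dvd (1 + d) ^ n - (1 + of_nat n * d)"
        by (rule one_plus_power_cong[OF d(1)])
      finally show "\<pi> ^ Suc s dvd (1 + d) ^ n - (1 + of_nat n * d)"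
        by (simp add: mult.commute)
      have "(1 + of_nat n * d) - (1 + z * d) = - ((z - of_nat n) * d)"
        by (simp add: algebra_simps)
      then show "\<pi> ^ Suc s dvd (1 + of_nat n * d) - (1 + z * d)"
        using n by (simp only: dvd_minus_iff dvd_mult2)
    qed
    ultimately show ?thesis
      unfolding power_mult_distrib by (rule dvd_diff_mult)
  qed
  ultimately show ?thesis by (rule dvd_diff_trans)
qed

section \<open>Teichmueller representatives\<close>

lemma totient_padic_q: "prime p \<Longrightarrow> totient (padic_q p) = (if p = 2 then 2 else p - 1)"
  using totient_prime_power_Suc[of 2 1] by (auto simp: padic_q_def totient_prime)

lemma totient_padic_q_pos: "totient (padic_q CARD('p::prime_card)) > 0"
  using CARD_gt_1[where 'p = 'p] by (simp add: totient_padic_q prime_card)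

lemma unit_if_root_of_unity:
  assumes "w ^ totient (padic_q CARD('p)) = (1 :: 'p::prime_card padic_int)"
  shows "is_unit w"
proof -
  have "is_unit (w ^ totient (padic_q CARD('p)))" using assms by simp
  then show ?thesis using totient_padic_q_pos[where 'p = 'p] by (simp add: is_unit_power_iff)
qed

text \<open>
  If \<open>1 + d\<close> is the quotient of the two roots of unity, of order dividing \<open>n = \<phi>(q)\<close>, then
  \<open>0 = (1 + d)\<^sup>n - 1\<close> is \<open>n d\<close> up to a unit.
\<close>

lemma teichmueller_unique:
  fixes w w' :: "'p::prime_card padic_int"
  assumes "w ^ totient (padic_q CARD('p)) = 1" "w' ^ totient (padic_q CARD('p)) = 1" "\<q> dvd w - w'"
  shows "w = w'"
proof -
  let ?n = "totient (padic_q CARD('p))"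
  obtain v where v: "w' * v = 1" using unit_if_root_of_unity[OF assms(2)] by (auto elim: dvdE)
  have "v ^ ?n = (w' * v) ^ ?n" by (simp add: power_mult_distrib assms(2))
  then have vn: "v ^ ?n = 1" by (simp add: v)
  define d where "d = (w - w') * v"
  have wv: "1 + d = w * v" using v by (simp add: d_def algebra_simps)
  have "\<q> dvd d" using assms(3) by (simp add: d_def)
  then obtain c where c: "is_unit c" "(1 + d) ^ ?n - 1 = of_nat ?n * d * c"
    by (rule one_plus_power_eq)
  have "(1 + d) ^ ?n - 1 = 0"
    unfolding wv by (simp add: power_mult_distrib assms(1) vn)
  then have "d = 0" using c totient_padic_q_pos[where 'p = 'p] by auto
  then have "w * v = w' * v" using wv v by simp
  moreover have "v \<noteq> 0" using v by auto
  ultimately show "w = w'" by simp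
qed

lemma euler_padic:
  assumes "is_unit (x :: 'p::prime_card padic_int)"
  shows "\<pi> ^ Suc n dvd x ^ (CARD('p) ^ n * (CARD('p) - 1)) - 1"
proof -
  let ?e = "CARD('p) ^ n * (CARD('p) - 1)"
  obtain m where m: "\<pi> ^ Suc n dvd x - of_nat m" by (rule near_nat)
  then have "\<pi> dvd x - of_nat m" unfolding power_Suc by (rule dvd_mult_left)
  then have "is_unit (of_nat m :: 'p padic_int)"
    using assms dvd_diff_sym unit_if_near_unit by metis
  then have "coprime CARD('p) m"
    using prime_card[where 'a = 'p] by (intro prime_imp_coprime) (simp_all add: unit_iff of_nat_dvd_iff)
  then have "coprime m (CARD('p) ^ Suc n)"
    by (simp add: coprime_commute)
  then have "[m ^ totient (CARD('p) ^ Suc n) = 1] (mod CARD('p) ^ Suc n)"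
    by (rule euler_theorem)
  then have "[m ^ ?e = 1] (mod CARD('p) ^ Suc n)"
    using prime_card[where 'a = 'p] by (simp only: totient_prime_power_Suc)
  then have "int CARD('p) ^ Suc n dvd int m ^ ?e - 1"
    unfolding cong_int_iff[symmetric] by (simp add: cong_iff_dvd_diff)
  then have "\<pi> ^ Suc n dvd (of_nat m ^ ?e - 1 :: 'p padic_int)"
    using of_int_power_dvd_iff[of "Suc n" "int m ^ ?e - 1", where 'p = 'p] by simp
  with dvd_diff_power[OF m] show ?thesis by (rule dvd_diff_trans)
qed

text \<open>
  For odd \<open>p\<close> the representative is the limit of \<open>x\<close> raised to the powers \<open>p\<^sup>n\<close>. For \<open>p = 2\<close>
  that limit is \<open>1\<close>, whereas the roots of unity to be found are \<open>\<plusminus>1\<close>.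
\<close>

lemma teichmueller_exists:
  assumes x: "is_unit (x :: 'p::prime_card padic_int)"
  shows "\<exists>w. w ^ totient (padic_q CARD('p)) = 1 \<and> \<q> dvd w - x"
proof (cases "CARD('p) = 2")
  case True
  obtain m where m: "\<pi> ^ 2 dvd x - of_nat m" by (rule near_nat)
  have pi: "(\<pi> :: 'p padic_int) = 2" and q: "(\<q> :: 'p padic_int) = \<pi> ^ 2"
    by (simp_all add: uniformizer_def True padic_q_def)
  from m have "\<pi> dvd x - of_nat m" unfolding power2_eq_square by (rule dvd_mult_left)
  then have "is_unit (of_nat m :: 'p padic_int)"
    using x dvd_diff_sym unit_if_near_unit by metis
  then have "odd m" by (simp add: unit_iff of_nat_dvd_iff True)
  then have "m mod 4 = 1 \<or> m mod 4 = 3" by presburger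
  then have "4 dvd int m - 1 \<or> 4 dvd int m - (- 1)" by presburger
  then obtain \<epsilon> :: int where \<epsilon>: "\<epsilon> = 1 \<or> \<epsilon> = - 1" "4 dvd int m - \<epsilon>" by blast
  then have "\<pi> ^ 2 dvd (of_int (int m - \<epsilon>) :: 'p padic_int)"
    unfolding of_int_power_dvd_iff by (simp add: True)
  then have "\<pi> ^ 2 dvd of_nat m - (of_int \<epsilon> :: 'p padic_int)" by simp
  with m have "\<q> dvd x - of_int \<epsilon>" unfolding q by (rule dvd_diff_trans)
  then have "\<q> dvd of_int \<epsilon> - x" by (rule dvd_diff_sym[THEN iffD1])
  moreover have "(of_int \<epsilon> :: 'p padic_int) ^ totient (padic_q CARD('p)) = 1"
    using \<epsilon>(1) True by (auto simp: totient_padic_q)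
  ultimately show ?thesis by blast
next
  case False
  let ?p = "CARD('p)"
  have n: "totient (padic_q ?p) = ?p - 1" and q: "(\<q> :: 'p padic_int) = \<pi>"
    using False prime_card[where 'a = 'p] by (simp_all add: totient_prime padic_q_def uniformizer_def)
  define s where "s n = x ^ (?p ^ n)" for n
  have step: "\<pi> ^ Suc n dvd s (Suc n) - s n" for n
  proof -
    have "?p ^ Suc n = ?p ^ n + ?p ^ n * (?p - 1)"
      using CARD_gt_1[where 'p = 'p] by (cases ?p) auto
    then have "s (Suc n) - s n = s n * (x ^ (?p ^ n * (?p - 1)) - 1)"
      by (simp add: s_def power_add right_diff_distrib)
    then show ?thesis using euler_padic[OF x, of n] by simp
  qed
  have "\<pi> ^ m dvd s (Suc n) - s n" if "n \<ge> m" for m n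
    using step[of n] that by (meson dvd_trans le_SucI le_imp_power_dvd)
  then obtain w where w: "\<And>m n. n \<ge> m \<Longrightarrow> \<pi> ^ m dvd s n - w"
    using padic_complete[of "\<lambda>m. m" s] by blast
  have "\<pi> ^ m dvd w ^ (?p - 1) - 1" for m
  proof -
    have "\<pi> ^ m dvd w - s m" using w[of m m] by (subst dvd_diff_sym) simp
    then have "\<pi> ^ m dvd w ^ (?p - 1) - s m ^ (?p - 1)" by (rule dvd_diff_power)
    moreover have "\<pi> ^ m dvd s m ^ (?p - 1) - 1"
      using euler_padic[OF x, of m] unfolding power_Suc s_def power_mult by (rule dvd_mult_right)
    ultimately show ?thesis by (rule dvd_diff_trans)
  qed
  then have "w ^ (?p - 1) = 1" using eq_0_if_all_powers_dvd[of "w ^ (?p - 1) - 1"] by simp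
  moreover have "\<pi> dvd w - x"
  proof -
    have "\<pi> dvd s 1 - w" using w[of 1 1] by simp
    moreover have "\<pi> dvd s 1 - x" using step[of 0] by (simp add: s_def)
    ultimately show ?thesis by (metis dvd_diff_sym dvd_diff_trans)
  qed
  ultimately show ?thesis by (auto simp: n q)
qed

lemma teichmueller_props:
  assumes "is_unit (x :: 'p::prime_card padic_int)"
  shows teichmueller_power: "teichmueller x ^ totient (padic_q CARD('p)) = 1"
    and teichmueller_near: "\<q> dvd teichmueller x - x"
proof -
  have "\<exists>!w. w ^ totient (padic_q CARD('p)) = 1 \<and> \<q> dvd w - x"
  proof (rule ex_ex1I[OF teichmueller_exists[OF assms]])
    fix w w' :: "'p padic_int"
    assume "w ^ totient (padic_q CARD('p)) = 1 \<and> \<q> dvd w - x"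
      "w' ^ totient (padic_q CARD('p)) = 1 \<and> \<q> dvd w' - x"
    then show "w = w'" by (metis teichmueller_unique dvd_diff_sym dvd_diff_trans)
  qed
  from theI'[OF this] show "teichmueller x ^ totient (padic_q CARD('p)) = 1"
    and "\<q> dvd teichmueller x - x" by (simp_all add: teichmueller_def)
qed

lemma teichmueller_unit: "is_unit (x :: 'p::prime_card padic_int) \<Longrightarrow> is_unit (teichmueller x)"
  by (rule unit_if_root_of_unity[OF teichmueller_power])

lemma unit_if_q_near_unit:
  assumes "\<q> dvd x - y" "is_unit (y :: 'p::prime_card padic_int)"
  shows "is_unit x"
  using assms uniformizer_dvd_q dvd_trans unit_if_near_unit by blast

lemma teichmueller_cong:
  assumes "\<q> dvd x - (y :: 'p::prime_card padic_int)" "is_unit y"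
  shows "teichmueller x = teichmueller y"
proof (rule teichmueller_unique)
  have x: "is_unit x" by (rule unit_if_q_near_unit[OF assms])
  show "teichmueller x ^ totient (padic_q CARD('p)) = 1" by (rule teichmueller_power[OF x])
  show "teichmueller y ^ totient (padic_q CARD('p)) = 1" by (rule teichmueller_power[OF assms(2)])
  show "\<q> dvd teichmueller x - teichmueller y"
    using teichmueller_near[OF x] teichmueller_near[OF assms(2)] assms(1)
    by (metis dvd_diff_sym dvd_diff_trans)
qed

lemma teichmueller_times_one_unit_part:
  "is_unit (x :: 'p::prime_card padic_int) \<Longrightarrow> teichmueller x * one_unit_part x = x"
  unfolding one_unit_part_def
  by (rule dvd_mult_div_cancel, rule unit_imp_dvd, rule teichmueller_unit)

lemma one_unit_part_near_1:
  assumes "is_unit (x :: 'p::prime_card padic_int)"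
  shows "\<q> dvd one_unit_part x - 1"
proof -
  have "\<q> dvd x - teichmueller x"
    using teichmueller_near[OF assms] by (rule dvd_diff_sym[THEN iffD1])
  also have "x - teichmueller x = teichmueller x * (one_unit_part x - 1)"
    using teichmueller_times_one_unit_part[OF assms] by (simp add: right_diff_distrib)
  finally show ?thesis
    using teichmueller_unit[OF assms] by (simp add: dvd_mult_unit_iff')
qed

section \<open>The map on pairs of a residue modulo \<open>p - 1\<close> and a \<open>p\<close>-adic unit\<close>

definition walk_map :: "int poly \<Rightarrow> int \<Rightarrow> 'p::prime_card padic_int \<Rightarrow> 'p padic_int" where
  "walk_map g x0 x = teichmueller x powi poly g x0 * one_unit_power x (poly_padic g x)"

lemma one_unit_power_eq: "one_unit_power x z = one_unit_powr (one_unit_part x) z"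
  by (simp add: one_unit_power_def one_unit_powr_def)

lemma walk_map_near:
  assumes "is_unit (x :: 'p::prime_card padic_int)"
  shows "\<q> dvd walk_map g x0 x - teichmueller x powi poly g x0"
proof -
  have "walk_map g x0 x - teichmueller x powi poly g x0
      = teichmueller x powi poly g x0 * (one_unit_powr (one_unit_part x) (poly_padic g x) - 1)"
    by (simp add: walk_map_def one_unit_power_eq right_diff_distrib)
  then show ?thesis
    using one_unit_powr_near_1[OF one_unit_part_near_1[OF assms]] by simp
qed

text \<open>
  The exponent of \<open>\<omega>(x)\<close> matters modulo \<open>\<phi>(q)\<close> only, and for the integral exponent \<open>g(x)\<close> the
  \<open>p\<close>-adic power of \<open>\<langle>x\<rangle>\<close> is the ordinary one. So the two factors recombine to a power of
  \<open>\<omega>(x)\<langle>x\<rangle> = x\<close>.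
\<close>

lemma walk_map_of_int:
  assumes "is_unit (of_int x :: 'p::prime_card padic_int)" "[x0 = x] (mod int (totient (padic_q CARD('p))))"
  shows "walk_map g x0 (of_int x) = (of_int x :: 'p padic_int) powi poly g x"
proof -
  let ?x = "of_int x :: 'p padic_int"
  have "x0 - x dvd poly g x0 - poly g x" by (rule dvd_poly_diff)
  then have "[poly g x0 = poly g x] (mod int (totient (padic_q CARD('p))))"
    using assms(2) unfolding cong_iff_dvd_diff by (rule dvd_trans[rotated])
  then have "teichmueller ?x powi poly g x0 = teichmueller ?x powi poly g x"
    by (intro powi_periodic[OF teichmueller_power[OF assms(1)] totient_padic_q_pos])
  moreover have "one_unit_power ?x (poly_padic g ?x) = one_unit_part ?x powi poly g x"
    unfolding one_unit_power_eq poly_padic_of_int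
    by (rule one_unit_powr_of_int[OF one_unit_part_near_1[OF assms(1)]])
  moreover have "is_unit (one_unit_part ?x)"
    using one_unit_part_near_1[OF assms(1)] by (rule unit_if_q_near_unit) simp
  ultimately have "walk_map g x0 ?x = (teichmueller ?x * one_unit_part ?x) powi poly g x"
    using teichmueller_unit[OF assms(1)] by (simp add: walk_map_def powi_mult_distrib)
  then show ?thesis by (simp add: teichmueller_times_one_unit_part[OF assms(1)])
qed

text \<open>
  The logarithmic derivative of \<open>walk_map g x0\<close> at \<open>y\<close> is \<open>g(y) / y\<close> modulo \<open>p\<close>: the
  derivative of the exponent contributes the factor \<open>log \<langle>y\<rangle>\<close>, which is \<open>0\<close> modulo \<open>p\<close>.
\<close>

lemma walk_map_diff:
  fixes x y :: "'p::prime_card padic_int"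
  assumes y: "is_unit y" and q: "\<q> dvd x - y" and s: "\<pi> ^ s dvd x - y"
  shows "\<pi> ^ Suc s dvd y * (walk_map g x0 x - walk_map g x0 y)
    - walk_map g x0 y * poly_padic g y * (x - y)"
proof -
  let ?G = "poly_padic g" and ?\<omega> = teichmueller and ?u = one_unit_part
  have x: "is_unit x" by (rule unit_if_q_near_unit[OF q y])
  obtain v where v: "y * v = 1" using y by (auto elim: dvdE)
  define d where "d = (x - y) * v"
  have "y * d = (y * v) * (x - y)" by (simp only: d_def mult_ac)
  then have yd: "y * d = x - y" by (simp add: v)
  have d: "\<q> dvd d" "\<pi> ^ s dvd d" using q s by (simp_all add: d_def)
  have \<omega>: "?\<omega> x = ?\<omega> y" by (rule teichmueller_cong[OF q y])
  have "?\<omega> y * ?u x = ?\<omega> y * (?u y * (1 + d))"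
    using teichmueller_times_one_unit_part[OF x] teichmueller_times_one_unit_part[OF y] yd
    by (simp add: \<omega> distrib_left mult.assoc[symmetric])
  moreover have "?\<omega> y \<noteq> 0" using teichmueller_unit[OF y] by auto
  ultimately have u: "?u x = ?u y * (1 + d)" by simp
  note uy = one_unit_part_near_1[OF y]
  have G: "\<pi> ^ s dvd ?G x - ?G y" using s dvd_poly_diff dvd_trans by blast
  have "\<pi> ^ Suc s dvd one_unit_powr (?u x) (?G x) - one_unit_powr (?u y) (?G x) * (1 + ?G x * d)"
    unfolding u by (rule one_unit_powr_base_cong[OF uy d])
  moreover have "\<pi> ^ Suc s dvd one_unit_powr (?u y) (?G x) * (1 + ?G x * d)
      - one_unit_powr (?u y) (?G y) * (1 + ?G y * d)"
  proof (rule dvd_diff_mult)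
    show "\<pi> ^ Suc s dvd one_unit_powr (?u y) (?G x) - one_unit_powr (?u y) (?G y)"
      by (rule one_unit_powr_cong[OF uy G])
    have "\<pi> ^ s * \<pi> dvd (?G x - ?G y) * d"
      using G d(1) uniformizer_dvd_q by (intro mult_dvd_mono) (auto intro: dvd_trans)
    then show "\<pi> ^ Suc s dvd (1 + ?G x * d) - (1 + ?G y * d)"
      by (simp add: mult.commute left_diff_distrib right_diff_distrib)
  qed
  ultimately have "\<pi> ^ Suc s dvd one_unit_powr (?u x) (?G x) - one_unit_powr (?u y) (?G y) * (1 + ?G y * d)"
    by (rule dvd_diff_trans)
  then have "\<pi> ^ Suc s dvd y * (?\<omega> y powi poly g x0 *
      (one_unit_powr (?u x) (?G x) - one_unit_powr (?u y) (?G y) * (1 + ?G y * d)))"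
    by (intro dvd_mult)
  also have "\<dots> = y * (walk_map g x0 x - walk_map g x0 y * (1 + ?G y * d))"
    by (simp add: walk_map_def one_unit_power_eq \<omega> right_diff_distrib mult.assoc)
  also have "\<dots> = y * (walk_map g x0 x - walk_map g x0 y) - walk_map g x0 y * ?G y * (y * d)"
    by (simp add: algebra_simps)
  finally show ?thesis by (simp only: yd)
qed

section \<open>Hensel lifting for a cycle of maps\<close>

lemma eq_if_all_powers_dvd_diff: "(\<And>n. \<pi> ^ n dvd x - y) \<Longrightarrow> x = y"
  using eq_0_if_all_powers_dvd[of "x - y"] by simp

lemma q_dvd_iff: "\<q> dvd x \<longleftrightarrow> \<pi> ^ q_exponent CARD('p) dvd (x :: 'p::prime_card padic_int)"
  by (simp add: q_padic_eq)

lemma power_dvd_weaken: "\<pi> ^ m dvd x \<Longrightarrow> n \<le> m \<Longrightarrow> \<pi> ^ n dvd x"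
  by (meson dvd_trans le_imp_power_dvd)

text \<open>
  Each \<open>F i\<close> maps the residue disc of \<open>a i\<close> to that of \<open>a (i + 1)\<close> and has derivative
  \<open>a (i + 1) c i / a i\<close> modulo \<open>p\<close>. Around the cycle the quotients of the \<open>a i\<close> cancel.
\<close>

locale cyclic_system =
  fixes F :: "nat \<Rightarrow> 'p::prime_card padic_int \<Rightarrow> 'p padic_int"
    and a c :: "nat \<Rightarrow> 'p padic_int" and k :: nat
  assumes unit: "i < k \<Longrightarrow> is_unit (a i)"
    and maps: "i < k \<Longrightarrow> \<q> dvd x - a i \<Longrightarrow> \<q> dvd F i x - a (Suc i)"
    and diff: "i < k \<Longrightarrow> \<q> dvd x - a i \<Longrightarrow> \<q> dvd y - a i \<Longrightarrow> \<pi> ^ s dvd x - y \<Longrightarrow>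
      \<pi> ^ Suc s dvd a i * (F i x - F i y) - a (Suc i) * c i * (x - y)"
    and k_pos: "k > 0"
    and cyclic: "a k = a 0"
    and not_1: "\<not> \<pi> dvd (\<Prod>i<k. c i) - 1"
begin

text \<open>
  Exact orbits in \<open>Z\<^sub>p\<close> and walks modulo \<open>p\<^sup>m\<close> are both instances, so that one estimate serves
  existence and uniqueness.
\<close>

definition approx_orbit :: "nat \<Rightarrow> (nat \<Rightarrow> 'p padic_int) \<Rightarrow> bool" where
  "approx_orbit m X \<longleftrightarrow>
     (\<forall>i<k. \<q> dvd X i - a i \<and> \<pi> ^ m dvd F i (X i) - X (Suc i))"

text \<open>
  The chain rule along the cycle, to first order. The telescoping quotient \<open>a j / a 0\<close> is cleared by
  multiplying with \<open>a 0\<close>.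
\<close>

lemma approx_orbit_diff:
  assumes X: "approx_orbit m X" and Y: "approx_orbit m Y"
    and s: "Suc s \<le> m" "\<pi> ^ s dvd X 0 - Y 0" and "j \<le> k"
  shows "\<pi> ^ Suc s dvd a 0 * (X j - Y j) - a j * (\<Prod>i<j. c i) * (X 0 - Y 0)"
  using \<open>j \<le> k\<close>
proof (induction j)
  case (Suc j)
  let ?P = "\<Prod>i<j. c i"
  have j: "j < k" and IH: "\<pi> ^ Suc s dvd a 0 * (X j - Y j) - a j * ?P * (X 0 - Y 0)"
    using Suc by simp_all
  have near: "\<q> dvd X j - a j" "\<q> dvd Y j - a j"
    and stepX: "\<pi> ^ m dvd F j (X j) - X (Suc j)" and stepY: "\<pi> ^ m dvd F j (Y j) - Y (Suc j)"
    using X Y j by (simp_all add: approx_orbit_def)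
  have "\<pi> ^ s dvd (a 0 * (X j - Y j) - a j * ?P * (X 0 - Y 0)) + a j * ?P * (X 0 - Y 0)"
    using power_dvd_weaken[OF IH, of s] s(2) by (intro dvd_add dvd_mult) simp_all
  then have "\<pi> ^ s dvd a 0 * (X j - Y j)" by simp
  then have "\<pi> ^ s dvd X j - Y j"
    using unit[OF k_pos] by (simp add: dvd_mult_unit_iff')
  then have D: "\<pi> ^ Suc s dvd a j * (F j (X j) - F j (Y j)) - a (Suc j) * c j * (X j - Y j)"
    by (rule diff[OF j near])
  have "\<pi> ^ Suc s dvd (F j (X j) - X (Suc j)) - (F j (Y j) - Y (Suc j))"
    using power_dvd_weaken[OF stepX s(1)] power_dvd_weaken[OF stepY s(1)] by (rule dvd_diff)
  then have "\<pi> ^ Suc s dvd a (Suc j) * c j * (a 0 * (X j - Y j) - a j * ?P * (X 0 - Y 0))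
      + a 0 * (a j * (F j (X j) - F j (Y j)) - a (Suc j) * c j * (X j - Y j))
      - a 0 * a j * ((F j (X j) - X (Suc j)) - (F j (Y j) - Y (Suc j)))"
    by (rule dvd_diff[OF dvd_add[OF dvd_mult[OF IH] dvd_mult[OF D]] dvd_mult])
  also have "\<dots> = a j * (a 0 * (X (Suc j) - Y (Suc j)) - a (Suc j) * (\<Prod>i<Suc j. c i) * (X 0 - Y 0))"
    by (simp add: algebra_simps)
  finally show ?case
    using unit[OF j] by (simp add: dvd_mult_unit_iff' del: prod.lessThan_Suc)
qed simp

lemma unit_1_minus_prod: "is_unit (1 - (\<Prod>i<k. c i))"
  using not_1 by (simp add: unit_iff dvd_diff_sym)

lemma F_cong:
  assumes "i < k" "\<q> dvd x - a i" "\<q> dvd y - a i" "\<pi> ^ s dvd x - y"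
  shows "\<pi> ^ s dvd F i x - F i y"
proof -
  have "\<pi> ^ s dvd (a i * (F i x - F i y) - a (Suc i) * c i * (x - y)) + a (Suc i) * c i * (x - y)"
    using power_dvd_weaken[OF diff[OF assms], of s] assms(4) by (intro dvd_add dvd_mult) simp_all
  then have "\<pi> ^ s dvd a i * (F i x - F i y)" by simp
  then show ?thesis using unit[OF assms(1)] by (simp add: dvd_mult_unit_iff')
qed

text \<open>
  If two approximate cycles agree modulo \<open>\<pi>\<^sup>s\<close>, then going around once multiplies their difference by
  the product of the \<open>c i\<close> and also leaves it unchanged; as the product is not \<open>1\<close> modulo \<open>p\<close>, the
  difference is divisible by \<open>\<pi>\<^sup>s\<^sup>+\<^sup>1\<close>.
\<close>

lemma approx_cycle_unique:
  assumes X: "approx_orbit m X" "X k = X 0" and Y: "approx_orbit m Y" "Y k = Y 0"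
    and "i < k"
  shows "\<pi> ^ m dvd X i - Y i"
proof -
  have "\<pi> ^ s dvd X 0 - Y 0" if "s \<le> m" for s
    using that
  proof (induction s)
    case (Suc s)
    then have "\<pi> ^ Suc s dvd a 0 * (X k - Y k) - a k * (\<Prod>i<k. c i) * (X 0 - Y 0)"
      by (intro approx_orbit_diff[OF X(1) Y(1)]) simp_all
    also have "\<dots> = a 0 * (1 - (\<Prod>i<k. c i)) * (X 0 - Y 0)"
      by (simp add: X Y cyclic algebra_simps)
    finally show ?case
      using unit_1_minus_prod unit[OF k_pos] by (simp add: dvd_mult_unit_iff' is_unit_mult_iff)
  qed simp
  then have base: "\<pi> ^ m dvd X 0 - Y 0" by simp
  show ?thesis
    using \<open>i < k\<close>
  proof (induction i)
    case (Suc i)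
    then have "\<pi> ^ m dvd F i (X i) - F i (Y i)"
      using X(1) Y(1) by (intro F_cong) (simp_all add: approx_orbit_def)
    moreover have "\<pi> ^ m dvd F i (X i) - X (Suc i)" "\<pi> ^ m dvd F i (Y i) - Y (Suc i)"
      using X(1) Y(1) Suc.prems by (simp_all add: approx_orbit_def)
    ultimately show ?case by (metis dvd_diff_sym dvd_diff_trans)
  qed (rule base)
qed

primrec orbit :: "'p padic_int \<Rightarrow> nat \<Rightarrow> 'p padic_int" where
  "orbit x 0 = x"
| "orbit x (Suc i) = F i (orbit x i)"

lemma orbit_near: "\<q> dvd x - a 0 \<Longrightarrow> i \<le> k \<Longrightarrow> \<q> dvd orbit x i - a i"
  by (induction i) (use maps in auto)

lemma approx_orbit_orbit: "\<q> dvd x - a 0 \<Longrightarrow> approx_orbit m (orbit x)"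
  by (auto simp: approx_orbit_def orbit_near)

lemma orbit_diff:
  assumes x: "\<q> dvd x - a 0" and y: "\<q> dvd y - a 0" and s: "\<pi> ^ s dvd x - y"
  shows "\<pi> ^ Suc s dvd (orbit x k - orbit y k) - (\<Prod>i<k. c i) * (x - y)"
proof -
  have "\<pi> ^ Suc s dvd a 0 * (orbit x k - orbit y k) - a k * (\<Prod>i<k. c i) * (orbit x 0 - orbit y 0)"
    by (rule approx_orbit_diff[OF approx_orbit_orbit[OF x] approx_orbit_orbit[OF y] order_refl]) (simp_all add: s)
  also have "\<dots> = a 0 * ((orbit x k - orbit y k) - (\<Prod>i<k. c i) * (x - y))"
    by (simp add: cyclic algebra_simps)
  finally show ?thesis using unit[OF k_pos] by (simp add: dvd_mult_unit_iff')
qed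

text \<open>
  Let \<open>H\<close> be the composition of the \<open>F i\<close> and \<open>C\<close> the product of the \<open>c i\<close>, so that
  \<open>H\<close> has derivative \<open>C\<close> modulo \<open>p\<close>. As \<open>1 - C\<close> is invertible, the fixed points of \<open>H\<close> are
  those of \<open>(H(x) - C x) / (1 - C)\<close>, which is a contraction.
\<close>

lemma cycle_exists: "\<exists>X. (\<forall>i<k. \<q> dvd X i - a i \<and> F i (X i) = X (Suc i)) \<and> X k = X 0"
proof -
  let ?C = "\<Prod>i<k. c i" and ?r = "q_exponent CARD('p)"
  obtain v where v: "(1 - ?C) * v = 1" using unit_1_minus_prod by (auto elim: dvdE)
  define f where "f x = v * (orbit x k - ?C * x)" for x
  obtain x where x: "\<pi> ^ ?r dvd x - a 0" "f x = x"
  proof (rule contraction_fixed_point[of ?r "a 0" f])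
    fix x assume "\<pi> ^ ?r dvd x - a 0"
    then have x: "\<q> dvd x - a 0" by (simp only: q_dvd_iff)
    have "f x - a 0 = f x - ((1 - ?C) * v) * a 0" by (simp only: v mult_1_left)
    also have "\<dots> = v * ((orbit x k - a k) - ?C * (x - a 0))"
      by (simp add: f_def cyclic algebra_simps)
    also have "\<q> dvd \<dots>"
      by (intro dvd_mult dvd_diff orbit_near[OF x] x) simp
    finally show "\<pi> ^ ?r dvd f x - a 0" by (simp only: q_dvd_iff)
  next
    fix s x y assume "\<pi> ^ ?r dvd x - a 0" "\<pi> ^ ?r dvd y - a 0" "\<pi> ^ s dvd x - y"
    then have "\<pi> ^ Suc s dvd v * ((orbit x k - orbit y k) - ?C * (x - y))"
      by (intro dvd_mult orbit_diff) (simp_all only: q_dvd_iff)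
    also have "\<dots> = f x - f y" by (simp add: f_def algebra_simps)
    finally show "\<pi> ^ Suc s dvd f x - f y" .
  qed
  have "orbit x k - ?C * x = ((1 - ?C) * v) * (orbit x k - ?C * x)" by (simp only: v mult_1_left)
  also have "\<dots> = (1 - ?C) * f x" by (simp only: f_def mult.assoc)
  also have "\<dots> = x - ?C * x" by (simp add: x(2) left_diff_distrib)
  finally have fixed: "orbit x k = x" by simp
  have near: "\<q> dvd x - a 0" using x(1) by (simp only: q_dvd_iff)
  show ?thesis
    by (rule exI[of _ "orbit x"]) (simp add: fixed orbit_near[OF near])
qed

end

lemma cyclic_system_walk_map:
  fixes g :: "int poly" and a :: "'p::prime_card padic_int list"
  assumes "k \<ge> 1" "\<And>i. i < k \<Longrightarrow> is_unit (a ! i)"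
    and "\<not> \<pi> dvd (\<Prod>i<k. poly_padic g (a ! i)) - 1"
    and adm: "\<And>i. i < k \<Longrightarrow> \<q> dvd teichmueller (a ! i) powi poly g (x0s ! i) - a ! (Suc i mod k)"
  shows "cyclic_system (\<lambda>i. walk_map g (x0s ! i)) (\<lambda>i. a ! (i mod k)) (\<lambda>i. poly_padic g (a ! i)) k"
proof
  let ?G = "poly_padic g :: 'p padic_int \<Rightarrow> 'p padic_int"
  show maps: "\<q> dvd walk_map g (x0s ! i) x - a ! (Suc i mod k)"
    if "i < k" "\<q> dvd x - a ! (i mod k)" for i x
  proof -
    have x: "\<q> dvd x - a ! i" and ai: "is_unit (a ! i)" using that assms(2) by simp_all
    have "\<q> dvd walk_map g (x0s ! i) x - teichmueller x powi poly g (x0s ! i)"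
      by (rule walk_map_near[OF unit_if_q_near_unit[OF x ai]])
    then show ?thesis
      using adm[OF that(1)] unfolding teichmueller_cong[OF x ai] by (rule dvd_diff_trans)
  qed
  show "\<pi> ^ Suc s dvd a ! (i mod k) * (walk_map g (x0s ! i) x - walk_map g (x0s ! i) y)
      - a ! (Suc i mod k) * ?G (a ! i) * (x - y)"
    if i: "i < k" and "\<q> dvd x - a ! (i mod k)" "\<q> dvd y - a ! (i mod k)" and s: "\<pi> ^ s dvd x - y"
    for i x y s
  proof -
    let ?F = "walk_map g (x0s ! i) :: 'p padic_int \<Rightarrow> 'p padic_int" and ?a = "a ! i" and ?a' = "a ! (Suc i mod k)"
    have x: "\<q> dvd x - ?a" and y: "\<q> dvd y - ?a" and ai: "is_unit ?a" using that assms(2) by simp_all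
    have yu: "is_unit y" by (rule unit_if_q_near_unit[OF y ai])
    have xy: "\<q> dvd x - y" using x y by (metis dvd_diff_sym dvd_diff_trans)
    have main: "\<pi> ^ Suc s dvd y * (?F x - ?F y) - ?F y * ?G y * (x - y)"
      by (rule walk_map_diff[OF yu xy s])
    have "\<pi> ^ s dvd (y * (?F x - ?F y) - ?F y * ?G y * (x - y)) + ?F y * ?G y * (x - y)"
      using power_dvd_weaken[OF main, of s] s by (intro dvd_add dvd_mult) simp_all
    then have "\<pi> ^ s dvd y * (?F x - ?F y)" by simp
    then have Fs: "\<pi> ^ s dvd ?F x - ?F y" using yu by (simp add: dvd_mult_unit_iff')
    have "\<q> dvd ?F y * ?G y - ?a' * ?G ?a"
      using maps[OF i, of y] y i dvd_poly_diff dvd_trans by (intro dvd_diff_mult) (auto intro: dvd_trans)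
    then have p1: "\<pi> dvd ?F y * ?G y - ?a' * ?G ?a" using uniformizer_dvd_q by (rule dvd_trans[rotated])
    have "\<q> dvd ?a - y" using y by (rule dvd_diff_sym[THEN iffD1])
    then have p2: "\<pi> dvd ?a - y" using uniformizer_dvd_q by (rule dvd_trans[rotated])
    have "\<pi> ^ Suc s dvd (?a - y) * (?F x - ?F y)" "\<pi> ^ Suc s dvd (?F y * ?G y - ?a' * ?G ?a) * (x - y)"
      unfolding power_Suc using p1 p2 Fs s by (intro mult_dvd_mono; simp)+
    then have "\<pi> ^ Suc s dvd (y * (?F x - ?F y) - ?F y * ?G y * (x - y)) + (?a - y) * (?F x - ?F y)
        + (?F y * ?G y - ?a' * ?G ?a) * (x - y)"
      using main by (intro dvd_add)
    also have "\<dots> = ?a * (?F x - ?F y) - ?a' * ?G ?a * (x - y)"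
      by (simp add: algebra_simps)
    finally show ?thesis using i by simp
  qed
qed (use assms in simp_all)

section \<open>Counting closed walks\<close>

text \<open>
  The shadow modulo \<open>q\<close> of the equations for walks: there \<open>\<langle>x\<rangle> = 1\<close>, and \<open>\<omega>(x\<^sub>i) = \<omega>(a\<^sub>i)\<close> is
  fixed, so that conditions on the residues modulo \<open>p - 1\<close> alone remain. These tuples index the
  solutions at every level.
\<close>

definition residue_cycles :: "int poly \<Rightarrow> nat \<Rightarrow> 'p::prime_card padic_int list \<Rightarrow> int list set" where
  "residue_cycles g k a = {x0s. length x0s = k \<and> (\<forall>i<k. x0s ! i \<in> {1..int CARD('p) - 1} \<and>
     \<q> dvd teichmueller (a ! i) powi poly g (x0s ! i) - a ! (Suc i mod k))}"

lemma finite_residue_cycles: "finite (residue_cycles g k (a :: 'p::prime_card padic_int list))"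
proof (rule finite_subset)
  show "residue_cycles g k a \<subseteq> {xs. set xs \<subseteq> {1..int CARD('p) - 1} \<and> length xs = k}"
    by (force simp: residue_cycles_def in_set_conv_nth)
qed (simp add: finite_lists_length_eq)

context
  fixes g :: "int poly" and k :: nat and a :: "'p::prime_card padic_int list"
  assumes k: "k \<ge> 1"
    and units: "\<forall>i<k. is_unit (a ! i)"
    and not_1: "\<not> \<pi> dvd (\<Prod>i<k. poly_padic g (a ! i)) - 1"
begin

lemma system_if_residue_cycle:
  "x0s \<in> residue_cycles g k a \<Longrightarrow>
     cyclic_system (\<lambda>i. walk_map g (x0s ! i)) (\<lambda>i. a ! (i mod k)) (\<lambda>i. poly_padic g (a ! i)) k"
  by (rule cyclic_system_walk_map[OF k _ not_1]) (use units in \<open>auto simp: residue_cycles_def\<close>)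

lemma residue_cycle_unique:
  assumes "x0s \<in> residue_cycles g k a"
    and "\<And>i. i < k \<Longrightarrow> \<q> dvd xs ! i - a ! i \<and> \<pi> ^ m dvd walk_map g (x0s ! i) (xs ! i) - xs ! (Suc i mod k)"
    and "\<And>i. i < k \<Longrightarrow> \<q> dvd ys ! i - a ! i \<and> \<pi> ^ m dvd walk_map g (x0s ! i) (ys ! i) - ys ! (Suc i mod k)"
    and "i < k"
  shows "\<pi> ^ m dvd xs ! i - ys ! i"
proof -
  interpret cyclic_system "\<lambda>i. walk_map g (x0s ! i)" "\<lambda>i. a ! (i mod k)" "\<lambda>i. poly_padic g (a ! i)" k
    by (rule system_if_residue_cycle[OF assms(1)])
  have "\<pi> ^ m dvd xs ! (i mod k) - ys ! (i mod k)"
    by (rule approx_cycle_unique[where X = "\<lambda>i. xs ! (i mod k)" and Y = "\<lambda>i. ys ! (i mod k)"])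
      (use assms in \<open>simp_all add: approx_orbit_def\<close>)
  with \<open>i < k\<close> show ?thesis by simp
qed

lemma residue_cycle_exists:
  assumes "x0s \<in> residue_cycles g k a"
  shows "\<exists>xs. length xs = k \<and>
    (\<forall>i<k. \<q> dvd xs ! i - a ! i \<and> walk_map g (x0s ! i) (xs ! i) = xs ! (Suc i mod k))"
proof -
  interpret cyclic_system "\<lambda>i. walk_map g (x0s ! i)" "\<lambda>i. a ! (i mod k)" "\<lambda>i. poly_padic g (a ! i)" k
    by (rule system_if_residue_cycle[OF assms(1)])
  obtain X where X: "\<forall>i<k. \<q> dvd X i - a ! (i mod k) \<and> walk_map g (x0s ! i) (X i) = X (Suc i)"
      "X k = X 0"
    using cycle_exists by blast
  have wrap: "X (Suc i mod k) = X (Suc i)" if "i < k" for i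
    using that X(2) by (cases "Suc i = k") auto
  show ?thesis
    by (rule exI[of _ "map X [0..<k]"]) (use X k wrap in simp)
qed

lemma bij_betw_walks_inf: "bij_betw snd (walks_inf g k a) (residue_cycles g k a)"
proof -
  have W: "(xs, x0s) \<in> walks_inf g k a \<longleftrightarrow> length xs = k \<and> length x0s = k \<and>
      (\<forall>i<k. x0s ! i \<in> {1..int CARD('p) - 1} \<and> \<q> dvd xs ! i - a ! i \<and>
        walk_map g (x0s ! i) (xs ! i) = xs ! (Suc i mod k))" for xs x0s
  proof -
    have "\<not> \<pi> dvd xs ! i" if "i < k" "\<q> dvd xs ! i - a ! i" for i
      using unit_if_q_near_unit[OF that(2) units[rule_format, OF that(1)]] by (simp add: unit_iff)
    then show ?thesis
      unfolding walks_inf_def walk_map_def uniformizer_def[symmetric] by auto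
  qed
  have sub: "x0s \<in> residue_cycles g k a" if "(xs, x0s) \<in> walks_inf g k a" for xs x0s
  proof -
    have "\<q> dvd teichmueller (a ! i) powi poly g (x0s ! i) - a ! (Suc i mod k)" if i: "i < k" for i
    proof -
      have near: "\<q> dvd xs ! j - a ! j" if "j < k" for j
        using \<open>(xs, x0s) \<in> _\<close> that by (simp add: W)
      have step: "walk_map g (x0s ! i) (xs ! i) = xs ! (Suc i mod k)"
        using \<open>(xs, x0s) \<in> _\<close> i by (simp add: W)
      have "\<q> dvd walk_map g (x0s ! i) (xs ! i) - teichmueller (xs ! i) powi poly g (x0s ! i)"
        by (rule walk_map_near[OF unit_if_q_near_unit[OF near[OF i] units[rule_format, OF i]]])
      then have "\<q> dvd teichmueller (a ! i) powi poly g (x0s ! i) - xs ! (Suc i mod k)"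
        unfolding teichmueller_cong[OF near[OF i] units[rule_format, OF i]] step by (rule dvd_diff_sym[THEN iffD1])
      moreover have "\<q> dvd xs ! (Suc i mod k) - a ! (Suc i mod k)"
        using k by (intro near) simp
      ultimately show ?thesis by (rule dvd_diff_trans)
    qed
    with that show ?thesis by (simp add: residue_cycles_def W)
  qed
  show ?thesis
  proof (rule bij_betw_imageI)
    show "inj_on snd (walks_inf g k a)"
    proof (rule inj_onI, clarify)
      fix xs x0s ys y0s
      assume *: "(xs, x0s) \<in> walks_inf g k a" "(ys, y0s) \<in> walks_inf g k a" "snd (xs, x0s) = snd (ys, y0s)"
      then have [simp]: "y0s = x0s" by simp
      have "xs ! i = ys ! i" if "i < k" for i
        by (rule eq_if_all_powers_dvd_diff, rule residue_cycle_unique[OF sub[OF *(1)]])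
          (use * that in \<open>simp_all add: W\<close>)
      with * show "xs = ys \<and> x0s = y0s" by (auto simp: W intro: nth_equalityI)
    qed
    show "snd ` walks_inf g k a = residue_cycles g k a"
    proof (intro equalityI subsetI)
      fix x0s assume x0s: "x0s \<in> residue_cycles g k a"
      obtain xs where "length xs = k"
          "\<forall>i<k. \<q> dvd xs ! i - a ! i \<and> walk_map g (x0s ! i) (xs ! i) = xs ! (Suc i mod k)"
        using residue_cycle_exists[OF x0s] by blast
      with x0s have "(xs, x0s) \<in> walks_inf g k a" by (simp add: W residue_cycles_def)
      then show "x0s \<in> snd ` walks_inf g k a" by force
    qed (use sub in auto)
  qed
qed

end

text \<open>
  Representatives are taken from \<open>{1..m}\<close> instead of \<open>{0..<m}\<close> because the entries of walks and the
  residues modulo \<open>p - 1\<close> both range over such intervals.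
\<close>

definition cyclic_rep :: "int \<Rightarrow> int \<Rightarrow> int" where
  "cyclic_rep m x = (x - 1) mod m + 1"

lemma cyclic_rep_range: "m > 0 \<Longrightarrow> 1 \<le> cyclic_rep m x \<and> cyclic_rep m x \<le> m"
  using pos_mod_bound[of m "x - 1"] pos_mod_sign[of m "x - 1"] unfolding cyclic_rep_def by linarith

lemma cyclic_rep_cong: "[cyclic_rep m x = x] (mod m)"
  unfolding cyclic_rep_def Cong.cong_def by (simp add: mod_add_left_eq)

lemma cyclic_rep_eq_iff: "cyclic_rep m x = cyclic_rep m y \<longleftrightarrow> [x = y] (mod m)"
  using cong_diff[of x y m 1 1] cong_add[of "x - 1" "y - 1" m 1 1]
  by (auto simp: cyclic_rep_def Cong.cong_def)

lemma cyclic_rep_id: "1 \<le> x \<Longrightarrow> x \<le> m \<Longrightarrow> cyclic_rep m x = x"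
  by (simp add: cyclic_rep_def)

lemma cyclic_unique: "1 \<le> (x :: int) \<Longrightarrow> x \<le> m \<Longrightarrow> 1 \<le> y \<Longrightarrow> y \<le> m \<Longrightarrow> [x = y] (mod m) \<Longrightarrow> x = y"
  using cyclic_rep_eq_iff[of m x y] cyclic_rep_id[of x m] cyclic_rep_id[of y m] by simp

lemma of_int_diff_dvd_iff:
  "\<pi> ^ n dvd (of_int x - of_int y :: 'p::prime_card padic_int) \<longleftrightarrow> [x = y] (mod int CARD('p) ^ n)"
  using of_int_power_dvd_iff[of n "x - y", where 'p = 'p] by (simp add: cong_iff_dvd_diff)

lemma powi_mod_cong:
  assumes "\<not> int CARD('p::prime_card) dvd x"
  shows "\<pi> ^ e dvd of_int (powi_mod (int CARD('p) ^ e) x n) - (of_int x :: 'p padic_int) powi n"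
proof -
  let ?m = "int CARD('p) ^ e" and ?x = "of_int x :: 'p padic_int"
  have reduce: "\<pi> ^ e dvd of_int (y mod ?m) - (of_int y :: 'p padic_int)" for y
    by (simp add: of_int_diff_dvd_iff)
  show ?thesis
  proof (cases "n \<ge> 0")
    case True
    then show ?thesis using reduce[of "x ^ nat n"] by (simp add: powi_mod_def power_int_def)
  next
    case False
    let ?y = "modular_inverse ?m x"
    have x: "is_unit ?x" using assms by (simp add: unit_iff of_int_dvd_iff)
    have "coprime (int CARD('p)) x"
      using prime_card_int assms by (intro prime_imp_coprime)
    then have "coprime x ?m" by (simp add: coprime_commute)
    then have "[?y * x = 1] (mod ?m)" by (rule cong_modular_inverse2)
    then have "\<pi> ^ e dvd of_int (?y * x) - (of_int 1 :: 'p padic_int)"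
      by (simp only: of_int_diff_dvd_iff)
    then have "\<pi> ^ e dvd (of_int ?y * ?x - 1) * inverse ?x" by simp
    also have "(of_int ?y * ?x - 1) * inverse ?x = of_int ?y * (?x * inverse ?x) - inverse ?x"
      by (simp add: left_diff_distrib mult.assoc)
    finally have "\<pi> ^ e dvd of_int ?y - inverse ?x"
      by (simp add: unit_mult_inverse[OF x])
    then have "\<pi> ^ e dvd of_int ?y ^ nat (- n) - inverse ?x ^ nat (- n)"
      by (rule dvd_diff_power)
    with reduce[of "?y ^ nat (- n)"] False show ?thesis
      by (auto simp: powi_mod_def power_int_def intro: dvd_diff_trans)
  qed
qed

lemma residue_cong_of_int:
  "\<pi> ^ n dvd (of_int x :: 'p::prime_card padic_int) - y \<longleftrightarrow> [x = residue y n] (mod int CARD('p) ^ n)"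
  by (simp add: uniformizer_power_dvd_diff_iff residue_of_int Cong.cong_def residue_mod)

lemma cong_totient_if_cong:
  assumes "\<not> int CARD('p::prime_card) dvd x" "x0 \<in> {1..int CARD('p) - 1}" "[x0 = x] (mod int CARD('p) - 1)"
  shows "[x0 = x] (mod int (totient (padic_q CARD('p))))"
proof (cases "CARD('p) = 2")
  case True
  then have "x0 = 1" "odd x" using assms by auto
  then show ?thesis
    using prime_card[where 'a = 'p] True by (simp add: totient_padic_q Cong.cong_def) presburger
next
  case False
  then show ?thesis
    using prime_card[where 'a = 'p] CARD_gt_1[where 'p = 'p] assms(3)
    by (simp add: totient_padic_q of_nat_diff)
qed

lemma dvd_diff_cong_left: "(d :: 'a::comm_ring_1) dvd x - x' \<Longrightarrow> d dvd x - y \<longleftrightarrow> d dvd x' - y"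
  using dvd_diff_trans[of d x x' y] dvd_diff_trans[of d x' x y] dvd_diff_sym[of d x x'] by blast

text \<open>
  Membership in \<open>walks\<close> in the form of the equations that define \<open>walks_inf\<close>, read modulo \<open>p\<^sup>e\<close>.
\<close>

lemma walks_iff:
  fixes a :: "'p::prime_card padic_int list"
  assumes "\<forall>i<k. is_unit (a ! i)"
  defines "x0 x \<equiv> cyclic_rep (int CARD('p) - 1) x"
  shows "xs \<in> walks g k a e \<longleftrightarrow> length xs = k \<and>
    (\<forall>i<k. 1 \<le> xs ! i \<and> xs ! i \<le> int CARD('p) ^ e * (int CARD('p) - 1) \<and>
      \<q> dvd of_int (xs ! i) - a ! i \<and>
      \<pi> ^ e dvd walk_map g (x0 (xs ! i)) (of_int (xs ! i) :: 'p padic_int) - of_int (xs ! (Suc i mod k)))"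
proof -
  have p1: "int CARD('p) - 1 > 0" using CARD_gt_1[where 'p = 'p] by simp
  have *: "\<not> int CARD('p) dvd xs ! i \<and>
     ([powi_mod (int CARD('p) ^ e) (xs ! i) (poly g (xs ! i)) = y] (mod int CARD('p) ^ e) \<longleftrightarrow>
      \<pi> ^ e dvd walk_map g (x0 (xs ! i)) (of_int (xs ! i) :: 'p padic_int) - of_int y)"
    if i: "i < k" and near: "\<q> dvd of_int (xs ! i) - a ! i" for i y
  proof -
    let ?x = "of_int (xs ! i) :: 'p padic_int" and ?z = "powi_mod (int CARD('p) ^ e) (xs ! i) (poly g (xs ! i))"
    have unit: "is_unit ?x" by (rule unit_if_q_near_unit[OF near assms(1)[rule_format, OF i]])
    then have nd: "\<not> int CARD('p) dvd xs ! i" by (simp add: unit_iff of_int_dvd_iff)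
    have "[x0 (xs ! i) = xs ! i] (mod int (totient (padic_q CARD('p))))"
      unfolding x0_def
      by (rule cong_totient_if_cong[OF nd _ cyclic_rep_cong]) (use cyclic_rep_range[OF p1] in simp)
    then have walk: "walk_map g (x0 (xs ! i)) ?x = ?x powi poly g (xs ! i)"
      by (rule walk_map_of_int[OF unit])
    have "\<pi> ^ e dvd of_int ?z - ?x powi poly g (xs ! i)"
      by (rule powi_mod_cong[OF nd])
    then have "\<pi> ^ e dvd (of_int ?z - of_int y :: 'p padic_int) \<longleftrightarrow> \<pi> ^ e dvd walk_map g (x0 (xs ! i)) ?x - of_int y"
      unfolding walk by (rule dvd_diff_cong_left)
    with nd show ?thesis unfolding of_int_diff_dvd_iff by (rule conjI)
  qed
  define A where "A i \<longleftrightarrow> [powi_mod (int CARD('p) ^ e) (xs ! i) (poly g (xs ! i)) = xs ! (Suc i mod k)] (mod int CARD('p) ^ e)" for i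
  define B where "B i \<longleftrightarrow> 1 \<le> xs ! i \<and> xs ! i \<le> int CARD('p) ^ e * (int CARD('p) - 1)" for i
  define N where "N i \<longleftrightarrow> \<not> int CARD('p) dvd xs ! i" for i
  define Q where "Q i \<longleftrightarrow> \<q> dvd of_int (xs ! i) - a ! i" for i
  define S where "S i \<longleftrightarrow> \<pi> ^ e dvd walk_map g (x0 (xs ! i)) (of_int (xs ! i) :: 'p padic_int) - of_int (xs ! (Suc i mod k))" for i
  have NAS: "N i \<and> (A i \<longleftrightarrow> S i)" if "i < k" "Q i" for i
    unfolding N_def A_def S_def by (rule *) (use that in \<open>simp_all only: Q_def\<close>)
  have pointwise: "A i \<and> B i \<and> N i \<and> Q i \<longleftrightarrow> B i \<and> Q i \<and> S i" if "i < k" for i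
    using NAS[OF that] by argo
  have "((\<forall>i<k. A i) \<and> (\<forall>i<k. B i \<and> N i \<and> Q i)) = (\<forall>i<k. A i \<and> B i \<and> N i \<and> Q i)"
    by fast
  moreover have "(\<forall>i<k. A i \<and> B i \<and> N i \<and> Q i) = (\<forall>i<k. B i \<and> Q i \<and> S i)"
    by (rule all_cong) (rule pointwise)
  ultimately have "((\<forall>i<k. A i) \<and> (\<forall>i<k. B i \<and> N i \<and> Q i)) = (\<forall>i<k. B i \<and> Q i \<and> S i)"
    by (rule trans)
  then show ?thesis
    by (simp only: walks_def rooted_closed_walk_def mem_Collect_eq A_def B_def N_def Q_def S_def conj_assoc)
qed

text \<open>
  A walk is determined by its residue cycle: the cycle fixes the entries modulo \<open>p - 1\<close> and, through
  unique lifting, modulo \<open>p\<^sup>e\<close>. Conversely the Chinese remainder theorem combines a residue cycle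
  with the reduction of its \<open>p\<close>-adic lift to a walk.
\<close>

lemma bij_betw_walks:
  fixes g :: "int poly" and a :: "'p::prime_card padic_int list"
  assumes k: "k \<ge> 1"
    and units: "\<forall>i<k. is_unit (a ! i)"
    and not_1: "\<not> \<pi> dvd (\<Prod>i<k. poly_padic g (a ! i)) - 1"
    and e: "e \<ge> q_exponent CARD('p)"
  shows "bij_betw (map (cyclic_rep (int CARD('p) - 1))) (walks g k a e) (residue_cycles g k a)"
proof (rule bij_betw_imageI)
  let ?p = "int CARD('p)"
  let ?x0 = "cyclic_rep (?p - 1)" and ?M = "?p ^ e * (?p - 1)"
  have p1: "?p - 1 > 0" and pe: "?p ^ e > 0" using CARD_gt_1[where 'p = 'p] by simp_all
  then have M: "?M > 0" by (simp add: zero_less_mult_iff)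
  have "coprime ?p (?p - 1)"
  proof (rule coprimeI)
    fix d assume "d dvd ?p" "d dvd ?p - 1"
    then have "d dvd ?p - (?p - 1)" by (rule dvd_diff)
    then show "is_unit d" by simp
  qed
  then have cop: "coprime (?p ^ e) (?p - 1)" by simp
  have e_q: "\<q> dvd x" if "\<pi> ^ e dvd x" for x :: "'p padic_int"
    using power_dvd_weaken[OF that e] by (simp add: q_dvd_iff)
  have sub: "map ?x0 xs \<in> residue_cycles g k a" if "xs \<in> walks g k a e" for xs
  proof -
    let ?X = "\<lambda>i. of_int (xs ! i) :: 'p padic_int"
    have len: "length xs = k" and near: "\<And>i. i < k \<Longrightarrow> \<q> dvd ?X i - a ! i"
      and step: "\<And>i. i < k \<Longrightarrow> \<pi> ^ e dvd walk_map g (?x0 (xs ! i)) (?X i) - ?X (Suc i mod k)"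
      using that by (simp_all add: walks_iff[OF units])
    have "\<q> dvd teichmueller (a ! i) powi poly g (?x0 (xs ! i)) - a ! (Suc i mod k)" if i: "i < k" for i
    proof -
      have "\<q> dvd walk_map g (?x0 (xs ! i)) (?X i) - teichmueller (?X i) powi poly g (?x0 (xs ! i))"
        by (rule walk_map_near[OF unit_if_q_near_unit[OF near[OF i] units[rule_format, OF i]]])
      then have "\<q> dvd teichmueller (a ! i) powi poly g (?x0 (xs ! i)) - walk_map g (?x0 (xs ! i)) (?X i)"
        unfolding teichmueller_cong[OF near[OF i] units[rule_format, OF i]] by (rule dvd_diff_sym[THEN iffD1])
      moreover have "\<q> dvd ?X (Suc i mod k) - a ! (Suc i mod k)"
        using k by (intro near) simp
      ultimately show ?thesis using e_q[OF step[OF i]] by (blast intro: dvd_diff_trans)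
    qed
    then show ?thesis
      using len cyclic_rep_range[OF p1] by (simp add: residue_cycles_def)
  qed
  show "inj_on (map ?x0) (walks g k a e)"
  proof (rule inj_onI)
    fix xs ys assume xs: "xs \<in> walks g k a e" and ys: "ys \<in> walks g k a e"
      and eq: "map ?x0 xs = map ?x0 ys"
    note xs' = xs[unfolded walks_iff[OF units]] and ys' = ys[unfolded walks_iff[OF units]]
    have x0: "?x0 (xs ! i) = ?x0 (ys ! i)" if "i < k" for i
      using arg_cong[OF eq, of "\<lambda>l. l ! i"] that xs' ys' by simp
    let ?I = "map of_int :: int list \<Rightarrow> 'p padic_int list"
    have I: "?I xs ! i = of_int (xs ! i)" "?I ys ! i = of_int (ys ! i)" "map ?x0 xs ! i = ?x0 (xs ! i)" if "i < k" for i
      using that xs' ys' by simp_all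
    have "xs ! i = ys ! i" if i: "i < k" for i
    proof -
      have succ: "Suc j mod k < k" for j using k by simp
      have "\<pi> ^ e dvd ?I xs ! i - ?I ys ! i"
        by (rule residue_cycle_unique[OF k units not_1 sub[OF xs] _ _ i])
          (use xs' ys' x0 in \<open>simp_all add: I succ\<close>)
      then have "[xs ! i = ys ! i] (mod ?p ^ e)"
        by (simp add: I i of_int_diff_dvd_iff)
      moreover have "[xs ! i = ys ! i] (mod ?p - 1)"
        using x0[OF i] by (simp add: cyclic_rep_eq_iff)
      ultimately have "[xs ! i = ys ! i] (mod ?M)"
        using cop by (rule coprime_cong_mult)
      with xs' ys' i show ?thesis by (intro cyclic_unique[of _ ?M]) simp_all
    qed
    with xs' ys' show "xs = ys" by (simp add: nth_equalityI)
  qed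
  show "map ?x0 ` walks g k a e = residue_cycles g k a"
  proof (intro equalityI subsetI)
    fix x0s assume x0s: "x0s \<in> residue_cycles g k a"
    have "\<exists>X. length X = k \<and>
        (\<forall>i<k. \<q> dvd X ! i - a ! i \<and> walk_map g (x0s ! i) (X ! i) = X ! (Suc i mod k))"
      by (rule residue_cycle_exists[OF k units not_1 x0s])
    then obtain X where X: "\<And>i. i < k \<Longrightarrow> \<q> dvd X ! i - a ! i"
        "\<And>i. i < k \<Longrightarrow> walk_map g (x0s ! i) (X ! i) = X ! (Suc i mod k)"
      by blast
    have "\<exists>x. 1 \<le> x \<and> x \<le> ?M \<and> \<pi> ^ e dvd of_int x - X ! i \<and> [x = x0s ! i] (mod ?p - 1)" for i
    proof -
      obtain x where x: "[x = residue (X ! i) e] (mod ?p ^ e)" "[x = x0s ! i] (mod ?p - 1)"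
        using binary_chinese_remainder_int[OF cop] by blast
      let ?y = "cyclic_rep ?M x"
      have y: "[?y = x] (mod ?M)" by (rule cyclic_rep_cong)
      then have "[?y = x] (mod ?p ^ e)" "[?y = x] (mod ?p - 1)"
        by (auto intro: cong_modulus_mult simp: mult.commute)
      then have "[?y = residue (X ! i) e] (mod ?p ^ e)" "[?y = x0s ! i] (mod ?p - 1)"
        using x cong_trans by blast+
      with cyclic_rep_range[OF M] show ?thesis
        by (auto simp: residue_cong_of_int)
    qed
    then obtain f where f: "\<And>i. 1 \<le> f i \<and> f i \<le> ?M \<and> \<pi> ^ e dvd of_int (f i) - X ! i \<and> [f i = x0s ! i] (mod ?p - 1)"
      by metis
    have x0: "?x0 (f i) = x0s ! i" if "i < k" for i
    proof -
      have "?x0 (f i) = ?x0 (x0s ! i)" using f by (simp add: cyclic_rep_eq_iff)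
      also have "\<dots> = x0s ! i" using x0s that by (intro cyclic_rep_id) (auto simp: residue_cycles_def)
      finally show ?thesis .
    qed
    let ?xs = "map f [0..<k]"
    have near: "\<q> dvd of_int (f i) - a ! i" if "i < k" for i
      using e_q[of "of_int (f i) - X ! i"] f X(1)[OF that] dvd_diff_trans by blast
    have step: "\<pi> ^ e dvd walk_map g (x0s ! i) (of_int (f i) :: 'p padic_int) - of_int (f (Suc i mod k))" if i: "i < k" for i
    proof -
      interpret cyclic_system "\<lambda>i. walk_map g (x0s ! i)" "\<lambda>i. a ! (i mod k)" "\<lambda>i. poly_padic g (a ! i)" k
        by (rule system_if_residue_cycle[OF k units not_1 x0s])
      have "\<pi> ^ e dvd walk_map g (x0s ! i) (of_int (f i)) - walk_map g (x0s ! i) (X ! i)"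
        using near[OF i] X(1)[OF i] f i by (intro F_cong) simp_all
      moreover have "\<pi> ^ e dvd X ! (Suc i mod k) - of_int (f (Suc i mod k))"
        using f by (subst dvd_diff_sym) blast
      ultimately show ?thesis unfolding X(2)[OF i] by (rule dvd_diff_trans)
    qed
    have "?xs \<in> walks g k a e"
      using f k near step by (simp add: walks_iff[OF units] x0)
    moreover have "map ?x0 ?xs = x0s"
      using x0s x0 by (auto simp: residue_cycles_def intro: nth_equalityI)
    ultimately show "x0s \<in> map ?x0 ` walks g k a e" by (metis imageI)
  qed (use sub in auto)
qed

text \<open>
  For \<open>p = 2\<close> the modulus \<open>p\<^sup>1\<close> does not determine residues modulo \<open>q = 4\<close>. Here the hypothesis on
  the product makes the values of \<open>g\<close> at odd numbers even, and squares of odd numbers are \<open>1\<close> modulo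
  \<open>4\<close>. So a residue cycle forces all \<open>a\<^sub>i\<close> to be \<open>1\<close> modulo \<open>4\<close>, as does a walk modulo \<open>2\<close>, whose
  entries lie in \<open>{1, 2}\<close>; in both sets the all-one tuple is then the only element.
\<close>

lemma walks_2_1:
  fixes g :: "int poly" and a :: "'p::prime_card padic_int list"
  assumes k: "k \<ge> 1"
    and units: "\<forall>i<k. is_unit (a ! i)"
    and not_1: "\<not> \<pi> dvd (\<Prod>i<k. poly_padic g (a ! i)) - 1"
    and p2: "CARD('p) = 2"
  shows "walks g k a 1 = residue_cycles g k a"
proof -
  have odd1: "\<pi> dvd x - 1" if "is_unit x" for x :: "'p padic_int"
  proof -
    obtain n where n: "\<pi> ^ 1 dvd x - of_nat n" by (rule near_nat)
    then have "is_unit (of_nat n :: 'p padic_int)"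
      using that unit_if_near_unit[of "of_nat n" x] by (simp add: dvd_diff_sym)
    then have "odd n" by (simp add: unit_iff of_nat_dvd_iff p2)
    then have "\<pi> ^ 1 dvd (of_int (int n) - of_int 1 :: 'p padic_int)"
      unfolding of_int_diff_dvd_iff by (simp add: p2 cong_iff_dvd_diff)
    with n show ?thesis by (simp add: dvd_diff_trans)
  qed
  have even: "even (poly g 1)"
  proof (rule ccontr)
    assume "odd (poly g 1)"
    then have u: "is_unit (of_int (poly g 1) :: 'p padic_int)"
      by (simp add: unit_iff of_int_dvd_iff p2)
    have at_1: "poly_padic g (1 :: 'p padic_int) = of_int (poly g 1)"
      using poly_padic_of_int[of g 1, where 'p = 'p] by simp
    have "is_unit (poly_padic g (a ! i))" if "i < k" for i
    proof (rule unit_if_near_unit[OF _ u])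
      have "a ! i - of_int 1 dvd poly_padic g (a ! i) - poly_padic g (of_int 1)"
        by (rule dvd_poly_diff)
      then show "\<pi> dvd poly_padic g (a ! i) - of_int (poly g 1)"
        using odd1[OF units[rule_format, OF that]] unfolding at_1 of_int_1 by (rule dvd_trans[rotated])
    qed
    then have "is_unit (\<Prod>i<k. poly_padic g (a ! i))"
      using prod_dvd_prod[of "{..<k}" "\<lambda>i. poly_padic g (a ! i)" "\<lambda>_. 1"] by simp
    with odd1 not_1 show False by blast
  qed
  have one: "teichmueller (a ! i) powi poly g 1 = 1" if "i < k" for i
  proof -
    have "teichmueller (a ! i) powi poly g 1 = teichmueller (a ! i) powi 0"
      by (rule powi_periodic[OF teichmueller_power[OF units[rule_format, OF that]] totient_padic_q_pos])
        (use even prime_card[where 'a = 'p] in \<open>simp add: totient_padic_q p2 cong_iff_dvd_diff\<close>)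
    then show ?thesis by simp
  qed
  have "xs \<in> residue_cycles g k a \<longleftrightarrow> length xs = k \<and> (\<forall>i<k. xs ! i = 1 \<and> \<q> dvd 1 - a ! i)" for xs
  proof -
    have "(\<forall>i<k. \<q> dvd 1 - a ! (Suc i mod k)) \<longleftrightarrow> (\<forall>i<k. \<q> dvd 1 - a ! i)"
    proof (intro iffI allI impI)
      fix i assume *: "\<forall>i<k. \<q> dvd 1 - a ! (Suc i mod k)" "i < k"
      \<comment> \<open>the cyclic predecessor of \<open>i\<close>\<close>
      let ?j = "(if i = 0 then k else i) - 1"
      have "?j < k" "Suc ?j mod k = i" using * by auto
      with * show "\<q> dvd 1 - a ! i" by metis
    qed (use k in simp)
    moreover have "xs ! i \<in> {1..int CARD('p) - 1} \<longleftrightarrow> xs ! i = 1" for i by (auto simp: p2)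
    ultimately show ?thesis
      unfolding residue_cycles_def mem_Collect_eq using one by (metis (no_types, lifting))
  qed
  moreover have "xs \<in> walks g k a 1 \<longleftrightarrow> length xs = k \<and> (\<forall>i<k. xs ! i = 1 \<and> \<q> dvd 1 - a ! i)" for xs
  proof -
    have range: "1 \<le> x \<and> x \<le> int CARD('p) ^ 1 * (int CARD('p) - 1) \<and> \<not> int CARD('p) dvd x \<longleftrightarrow> x = 1" for x
      by (auto simp: p2) presburger
    have "rooted_closed_walk g (int CARD('p) ^ 1) k xs" if "length xs = k" "\<forall>i<k. xs ! i = 1"
      using that k by (simp add: rooted_closed_walk_def powi_mod_def p2)
    then show ?thesis
      unfolding walks_def mem_Collect_eq using range rooted_closed_walk_def
      by (metis (no_types, lifting) of_int_1)
  qed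
  ultimately show ?thesis by blast
qed

lemma card_walks:
  fixes g :: "int poly" and a :: "'p::prime_card padic_int list"
  assumes k: "k \<ge> 1"
    and units: "\<forall>i<k. is_unit (a ! i)"
    and not_1: "\<not> \<pi> dvd (\<Prod>i<k. poly_padic g (a ! i)) - 1"
    and "e \<ge> 1"
  shows "card (walks g k a e) = card (residue_cycles g k a)"
proof (cases "e \<ge> q_exponent CARD('p)")
  case True
  show ?thesis by (rule bij_betw_same_card[OF bij_betw_walks[OF k units not_1 True]])
next
  case False
  with \<open>e \<ge> 1\<close> have "CARD('p) = 2" "e = 1" by (auto simp: q_exponent_def split: if_splits)
  then show ?thesis using walks_2_1[OF k units not_1] by simp
qed

lemma walks_empty_if_nonunit:
  fixes a :: "'p::prime_card padic_int list"
  assumes "i < k" "\<not> is_unit (a ! i)"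
  shows "walks g k a e = {}" "walks_inf g k a = {}"
proof -
  have "\<pi> dvd x" if "\<q> dvd x - a ! i" for x
    using that assms(2) unit_if_q_near_unit[of "a ! i" x] by (auto simp: unit_iff dvd_diff_sym)
  then show "walks g k a e = {}" "walks_inf g k a = {}"
    using assms(1) of_int_dvd_iff[where 'p = 'p]
    unfolding walks_def walks_inf_def uniformizer_def by blast+
qed

theorem theorem14:
  fixes g :: "int poly" and k e :: nat and a :: "'p::prime_card padic_int list"
  assumes "k \<ge> 1" and "length a = k"
    and "\<not> of_nat CARD('p) dvd (\<Prod>i<k. poly_padic g (a ! i)) - 1"
    and "e \<ge> 1"
  shows "finite (walks_inf g k a) \<and>
    card (walks g k a e) = card (walks_inf g k a) \<and>
    card (walks_inf g k a) = card (walks g k a 1)"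
proof (cases "\<forall>i<k. is_unit (a ! i)")
  case True
  have not_1: "\<not> \<pi> dvd (\<Prod>i<k. poly_padic g (a ! i)) - 1"
    using assms(3) by (simp add: uniformizer_def)
  note units = True
  note bij = bij_betw_walks_inf[OF assms(1) units not_1]
  show ?thesis
    using bij_betw_finite[OF bij] bij_betw_same_card[OF bij] finite_residue_cycles[of g k a]
      card_walks[OF assms(1) units not_1 assms(4)] card_walks[OF assms(1) units not_1, of 1]
    by simp
next
  case False
  then show ?thesis using walks_empty_if_nonunit by (metis card.empty finite.emptyI)
qed

end
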